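(* Fix $c>1$. There exist constants $C_b>0$ and $C_B>1$ such that with high probability the largest component $H_{n,c/n}$ of $G_{n,c/n}$ has the property that every Lipschitz function $f:V(H_{n,c/n})\to\mathbb{R}$ satisfies $$|\{v\in V(H_{n,c/n}): |f(v)-m|> x\}| < C_b\, C_B^{-\sqrt{x}}\, n \qquad\text{for all } x\ge 0,$$ where $m$ is a median of $f$.
   Context: $G_{n,p}$ is the Erdős–Rényi random graph on $n$ vertices with edge probability $p$; $H_{n,p}$ denotes its largest component. "With high probability" means with probability $1-o(1)$ as $n\to\infty$. A Lipschitz function on a graph is a real function on its vertices with $|f(v)-f(w)|\le1$ for adjacent $v,w$. A function on the vertex set is regarded as a random variable evaluated at a uniformly random vertex of $H_{n,c/n}$; a median $m$ of $f$ is a real number such that at least half of the vertices of $H_{n,c/n}$ have $f(v)\ge m$ and at least half have $f(v)\le m$. *)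

theory Defs
  imports "HOL-Probability.Probability"
begin

text \<open>A graph on vertex set {..<n} is encoded as a predicate on pairs (i,j) with i < j < n
  (the edge {i,j}); all other pairs are False.\<close>

definition gnp_pairs :: "nat \<Rightarrow> (nat \<times> nat) set" where
  "gnp_pairs n = {(i, j). i < j \<and> j < n}"

definition gnp :: "nat \<Rightarrow> real \<Rightarrow> (nat \<times> nat \<Rightarrow> bool) pmf" where
  "gnp n p = Pi_pmf (gnp_pairs n) False (\<lambda>_. bernoulli_pmf p)"

definition adj :: "(nat \<times> nat \<Rightarrow> bool) \<Rightarrow> nat \<Rightarrow> nat \<Rightarrow> bool" where
  "adj G u v \<longleftrightarrow> (u < v \<and> G (u, v)) \<or> (v < u \<and> G (v, u))"

definition component :: "nat \<Rightarrow> (nat \<times> nat \<Rightarrow> bool) \<Rightarrow> nat \<Rightarrow> nat set" where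
  "component n G v = {w. w < n \<and> (adj G)\<^sup>*\<^sup>* v w}"

definition components :: "nat \<Rightarrow> (nat \<times> nat \<Rightarrow> bool) \<Rightarrow> nat set set" where
  "components n G = component n G ` {..<n}"

definition largest_component :: "nat \<Rightarrow> (nat \<times> nat \<Rightarrow> bool) \<Rightarrow> nat set \<Rightarrow> bool" where
  "largest_component n G H \<longleftrightarrow> H \<in> components n G \<and> (\<forall>H' \<in> components n G. card H' \<le> card H)"

definition lipschitz_on_graph :: "(nat \<times> nat \<Rightarrow> bool) \<Rightarrow> nat set \<Rightarrow> (nat \<Rightarrow> real) \<Rightarrow> bool" where
  "lipschitz_on_graph G H f \<longleftrightarrow> (\<forall>v \<in> H. \<forall>w \<in> H. adj G v w \<longrightarrow> \<bar>f v - f w\<bar> \<le> 1)"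

definition is_median :: "nat set \<Rightarrow> (nat \<Rightarrow> real) \<Rightarrow> real \<Rightarrow> bool" where
  "is_median H f m \<longleftrightarrow> 2 * card {v \<in> H. f v \<ge> m} \<ge> card H \<and> 2 * card {v \<in> H. f v \<le> m} \<ge> card H"

definition concentration_property :: "real \<Rightarrow> real \<Rightarrow> nat \<Rightarrow> (nat \<times> nat \<Rightarrow> bool) \<Rightarrow> bool" where
  "concentration_property Cb CB n G \<longleftrightarrow>
     (\<forall>H. largest_component n G H \<longrightarrow>
        (\<forall>f. lipschitz_on_graph G H f \<longrightarrow>
          (\<forall>m. is_median H f m \<longrightarrow>
            (\<forall>x::real. x \<ge> 0 \<longrightarrow>
               real (card {v \<in> H. \<bar>f v - m\<bar> > x}) < Cb * CB powr (- sqrt x) * real n))))"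

end

theory Submission
  imports Defs "HOL-Real_Asymp.Real_Asymp"
begin

text \<open>
  Write \<open>G\<close> as the union of two independent random graphs \<open>G1\<close> (still supercritical) and \<open>G2\<close>
  (sprinkling, with edge probability at least \<open>\<epsilon> / n\<close>). Depth-first search finds a path \<open>Q\<close> with
  \<open>\<gamma> n\<close> vertices in \<open>G1\<close>. Three properties then hold with high probability.

  (1) Slow growth: \<open>|N\<^sub>j(T)| \<le> 4 C\<^sup>j sqrt (|T| n)\<close> for all vertex sets \<open>T\<close> and all radii \<open>j\<close>, from an
  exponential moment of the breadth-first exploration and a union bound over \<open>T\<close>.

  (2) Expansion: every \<open>T \<subseteq> Q\<close> that is not almost all of \<open>Q\<close> has at least \<open>\<phi> |T| / (1 + ln (n / |T|))\<close>
  boundary vertices in \<open>Q\<close>. A set with few boundary vertices consists of few intervals of the path,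
  so there are few such sets, and sprinkling inside \<open>Q\<close> destroys all of them.

  (3) Only \<open>2 n \<beta>\<^sup>k\<close> vertices with more than \<open>k\<close> vertices in their \<open>k\<close>-ball outside \<open>Q\<close> fail to
  reach \<open>Q\<close> from that ball, since each vertex of the ball has an independent chance of being joined to \<open>Q\<close>
  by a sprinkled edge.

  By (1) and (3), the set where \<open>f\<close> is at most its median is within bounded distance of a positive
  fraction of \<open>Q\<close>. By (2), \<open>u = 1 + ln (n / t)\<close>, where \<open>t\<close> is the number of vertices of \<open>Q\<close> at height above
  \<open>k\<close>, grows by a constant times \<open>1 / u\<close> in each step, whence \<open>u \<ge> a sqrt k\<close>. Finally (3) and (1) with
  radius proportional to \<open>sqrt k\<close> transfer the bound from \<open>Q\<close> to the whole component.
\<close>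

section \<open>Independent edges\<close>

text \<open>The index set is arbitrary so that the pairs of a random graph can be split into
  disjoint blocks that are revealed one after the other.\<close>

definition rgraph :: "'a set \<Rightarrow> real \<Rightarrow> ('a \<Rightarrow> bool) pmf" where
  "rgraph A p = Pi_pmf A False (\<lambda>_. bernoulli_pmf p)"

lemma finite_set_rgraph: "finite A \<Longrightarrow> finite (set_pmf (rgraph A p))"
  unfolding rgraph_def by (rule finite_subset[OF set_Pi_pmf_subset']) auto

lemma integrable_rgraph: "finite A \<Longrightarrow> integrable (rgraph A p) (f :: _ \<Rightarrow> real)"
  by (intro integrable_measure_pmf_finite finite_set_rgraph)

lemma set_rgraphD: "finite A \<Longrightarrow> g \<in> set_pmf (rgraph A p) \<Longrightarrow> g e \<Longrightarrow> e \<in> A"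
  unfolding rgraph_def using set_Pi_pmf_subset[of A False "\<lambda>_. bernoulli_pmf p"] by blast

lemma expectation_pair_finite:
  fixes f :: "'a \<times> 'b \<Rightarrow> real"
  assumes "finite (set_pmf A)" "finite (set_pmf B)"
  shows "measure_pmf.expectation (pair_pmf A B) f =
         measure_pmf.expectation A (\<lambda>a. measure_pmf.expectation B (\<lambda>b. f (a, b)))"
proof -
  have "measure_pmf.expectation (pair_pmf A B) f = 
    (\<Sum>x\<in>set_pmf A \<times> set_pmf B. pmf (pair_pmf A B) x *\<^sub>R f x)"
    by (rule integral_measure_pmf) (use assms in auto)
  also have "\<dots> = (\<Sum>a\<in>set_pmf A. \<Sum>b\<in>set_pmf B. pmf A a * (pmf B b * f (a, b)))"
    unfolding sum.cartesian_product by (intro sum.cong) (auto simp: pmf_pair mult.assoc)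
  also have "\<dots> = (\<Sum>a\<in>set_pmf A. pmf A a *\<^sub>R measure_pmf.expectation B (\<lambda>b. f (a, b)))"
    by (subst integral_measure_pmf[OF assms(2)]) (auto simp: set_pmf_eq sum_distrib_left)
  also have "\<dots> = measure_pmf.expectation A (\<lambda>a. measure_pmf.expectation B (\<lambda>b. f (a, b)))"
    by (rule integral_measure_pmf[symmetric]) (use assms in \<open>auto simp: set_pmf_eq\<close>)
  finally show ?thesis .
qed

text \<open>Conditioning on the first component: a bound valid for each fixed value of it survives
  averaging.\<close>

lemma prob_pair_finite_le:
  assumes "finite (set_pmf A)" "finite (set_pmf B)"
    and "\<And>a. a \<in> set_pmf A \<Longrightarrow> measure_pmf.prob B {b. (a, b) \<in> E} \<le> r"
  shows "measure_pmf.prob (pair_pmf A B) E \<le> r"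
proof -
  have "measure_pmf.prob (pair_pmf A B) E = measure_pmf.expectation (pair_pmf A B) (indicator E)"
    by simp
  also have "\<dots> = measure_pmf.expectation A (\<lambda>a. measure_pmf.expectation B (\<lambda>b. indicator E (a, b)))"
    by (rule expectation_pair_finite[OF assms(1,2)])
  also have "\<dots> = measure_pmf.expectation A (\<lambda>a. measure_pmf.prob B {b. (a, b) \<in> E})"
  proof -
    have "measure_pmf.expectation B (\<lambda>b. indicator E (a, b)) = measure_pmf.prob B {b. (a, b) \<in> E}" for a
    proof -
      have "(\<lambda>b. indicator E (a, b) :: real) = indicator {b. (a, b) \<in> E}"
        by (auto simp: indicator_def)
      then show ?thesis by simp
    qed
    then show ?thesis by simp
  qed
  also have "\<dots> \<le> measure_pmf.expectation A (\<lambda>a. r)"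
    by (intro integral_mono_AE integrable_measure_pmf_finite assms(1) AE_pmfI) (use assms(3) in auto)
  finally show ?thesis by simp
qed

lemma expectation_rgraph_Un:
  fixes f :: "_ \<Rightarrow> real"
  assumes "finite A" "finite B" "A \<inter> B = {}"
  shows "measure_pmf.expectation (rgraph (A \<union> B) p) f =
    measure_pmf.expectation (rgraph A p) (\<lambda>g. measure_pmf.expectation (rgraph B p)
      (\<lambda>h. f (\<lambda>e. if e \<in> A then g e else h e)))"
proof -
  have "rgraph (A \<union> B) p = map_pmf (\<lambda>(f,g) x. if x \<in> A then f x else g x) (pair_pmf (rgraph A p) (rgraph B p))"
    unfolding rgraph_def by (rule Pi_pmf_union[OF assms])
  then show ?thesis
    by (simp add: expectation_pair_finite finite_set_rgraph assms case_prod_unfold)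
qed

text \<open>Block \<open>B\<close> is revealed first and its outcome \<open>h\<close> stays fixed
  while \<open>A\<close> is still random; this keeps the pairs leaving the path fresh later
  on.\<close>

lemma prob_rgraph_Un_le:
  assumes "finite A" "finite B" "A \<inter> B = {}"
    and "\<And>h. h \<in> set_pmf (rgraph B p) \<Longrightarrow>
      measure_pmf.prob (rgraph A p) {g. P (\<lambda>e. if e \<in> A then g e else h e)} \<le> r"
  shows "measure_pmf.prob (rgraph (A \<union> B) p) {g. P g} \<le> r"
proof -
  have "rgraph (A \<union> B) p = map_pmf (\<lambda>(f,g) x. if x \<in> A then f x else g x) (pair_pmf (rgraph A p) (rgraph B p))"
    unfolding rgraph_def by (rule Pi_pmf_union[OF assms(1-3)])
  also have "\<dots> = map_pmf (\<lambda>(h,g) x. if x \<in> A then g x else h x) (pair_pmf (rgraph B p) (rgraph A p))"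
    by (subst pair_commute_pmf) (simp add: pmf.map_comp o_def case_prod_unfold)
  finally have "measure_pmf.prob (rgraph (A \<union> B) p) {g. P g} = measure_pmf.prob (pair_pmf (rgraph B p) (rgraph A p))
     {x. P (\<lambda>e. if e \<in> A then snd x e else fst x e)}"
    by (simp add: case_prod_unfold vimage_def)
  also have "\<dots> \<le> r"
  proof (rule prob_pair_finite_le)
    fix h assume "h \<in> set_pmf (rgraph B p)"
    from assms(4)[OF this] show "measure_pmf.prob (rgraph A p)
      {g. (h, g) \<in> {x. P (\<lambda>e. if e \<in> A then snd x e else fst x e)}} \<le> r"
      by (simp only: mem_Collect_eq fst_conv snd_conv)
  qed (simp_all add: finite_set_rgraph assms)
  finally show ?thesis .
qed

lemma prob_rgraph_none:
  assumes "finite A" "E \<subseteq> A" "0 \<le> p" "p \<le> 1"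
  shows "measure_pmf.prob (rgraph A p) {g. \<forall>e\<in>E. \<not> g e} = (1 - p) ^ card E"
proof -
  have "{g. \<forall>e\<in>E. \<not> g e} = Pi A (\<lambda>e. if e \<in> E then {False} else UNIV)"
    using assms(2) by (auto simp: Pi_def)
  then have "measure_pmf.prob (rgraph A p) {g. \<forall>e\<in>E. \<not> g e} =
     (\<Prod>e\<in>A. measure_pmf.prob (bernoulli_pmf p) (if e \<in> E then {False} else UNIV))"
    unfolding rgraph_def by (simp add: measure_Pi_pmf_Pi assms(1))
  also have "\<dots> = (\<Prod>e\<in>A. if e \<in> E then 1 - p else 1)"
    by (intro prod.cong) (use assms in \<open>auto simp: measure_pmf_single\<close>)
  also have "\<dots> = (1 - p) ^ card E"
    using assms(1,2) by (simp add: prod.If_cases Int_absorb1)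
  finally show ?thesis .
qed

text \<open>By independence the moment generating function is a product of factors
  \<open>1 + p * (exp a - 1)\<close>, each at most \<open>exp (p * (exp a - 1))\<close>.\<close>

lemma expectation_rgraph_exp:
  fixes a p :: real
  assumes "finite A" "0 \<le> p" "p \<le> 1" "0 \<le> a"
  shows "measure_pmf.expectation (rgraph A p) (\<lambda>g. exp (a * card {e\<in>A. g e}))
     \<le> exp (p * (exp a - 1) * card A)"
proof -
  have "exp (a * card {e\<in>A. g e}) = (\<Prod>e\<in>A. if g e then exp a else 1)" for g
    using assms(1) by (simp add: prod.If_cases Int_def exp_of_nat2_mult)
  then have "measure_pmf.expectation (rgraph A p) (\<lambda>g. exp (a * card {e\<in>A. g e}))
     = measure_pmf.expectation (rgraph A p) (\<lambda>g. \<Prod>e\<in>A. if g e then exp a else 1)" by simp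
  also have "\<dots> = (\<Prod>e\<in>A. measure_pmf.expectation (bernoulli_pmf p) (\<lambda>b. if b then exp a else 1))"
    unfolding rgraph_def
    by (rule expectation_prod_Pi_pmf) (use assms in \<open>auto intro!: integrable_measure_pmf_finite\<close>)
  also have "\<dots> = (1 + p * (exp a - 1)) ^ card A"
    using assms by (simp add: algebra_simps)
  also have "\<dots> \<le> exp (p * (exp a - 1)) ^ card A"
    using assms by (intro power_mono) auto
  also have "\<dots> = exp (p * (exp a - 1) * card A)"
    by (simp add: exp_of_nat2_mult)
  finally show ?thesis .
qed

lemma gnp_eq_rgraph: "gnp n p = rgraph (gnp_pairs n) p"
  by (simp add: gnp_def rgraph_def)

lemma finite_gnp_pairs: "finite (gnp_pairs n)"
  by (rule finite_subset[of _ "{..<n} \<times> {..<n}"]) (auto simp: gnp_pairs_def)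

lemma bernoulli_or:
  assumes "0 \<le> p" "p \<le> 1" "0 \<le> q" "q \<le> 1" "1 - r = (1 - p) * (1 - q)"
  shows "bernoulli_pmf r = map_pmf (\<lambda>(a, b). a \<or> b) (pair_pmf (bernoulli_pmf p) (bernoulli_pmf q))"
proof (rule pmf_eqI)
  fix b
  have r: "0 \<le> r" "r \<le> 1" 
    using assms mult_le_one[of "1 - p" "1 - q"] mult_nonneg_nonneg[of "1 - p" "1 - q"] by linarith+
  have F: "pmf (map_pmf (\<lambda>(a, b). a \<or> b) (pair_pmf (bernoulli_pmf p) (bernoulli_pmf q))) False = 1 - r"
  proof -
    have "(\<lambda>(a, b). a \<or> b) -` {False} = {(False, False)}" by auto
    then show ?thesis using assms by (simp add: pmf_map measure_pmf_single pmf_pair)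
  qed
  show "pmf (bernoulli_pmf r) b = pmf (map_pmf (\<lambda>(a, b). a \<or> b) (pair_pmf (bernoulli_pmf p) (bernoulli_pmf q))) b"
  proof (cases b)
    case False then show ?thesis using F r by simp
  next
    case True
    have "pmf (map_pmf (\<lambda>(a, b). a \<or> b) (pair_pmf (bernoulli_pmf p) (bernoulli_pmf q))) True = 1 - (1 - r)"
      unfolding F[symmetric] by (rule pmf_True_conv_False)
    then show ?thesis using True r by simp
  qed
qed

text \<open>Sprinkling: a pair is absent from the overlay exactly if it is absent from both
  independent graphs. The induction inserts one pair at a time.\<close>

lemma rgraph_or:
  assumes "finite A" "0 \<le> p" "p \<le> 1" "0 \<le> q" "q \<le> 1" "1 - r = (1 - p) * (1 - q)"
  shows "rgraph A r = map_pmf (\<lambda>(g, h) e. g e \<or> h e) (pair_pmf (rgraph A p) (rgraph A q))"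
  using assms(1)
proof (induction rule: finite_induct)
  case empty
  then show ?case by (simp add: rgraph_def)
next
  case (insert x A)
  have 1: "rgraph (insert x A) s = do {y \<leftarrow> bernoulli_pmf s; f \<leftarrow> rgraph A s; return_pmf (f(x := y))}" for s
    unfolding rgraph_def using insert by (simp add: Pi_pmf_insert')
  have upd: "(\<lambda>e. (g(x := a)) e \<or> (h(x := b)) e) = (\<lambda>e. g e \<or> h e)(x := a \<or> b)" for g h :: "_ \<Rightarrow> bool" and a b
    by auto
  have "map_pmf (\<lambda>(g, h) e. g e \<or> h e) (pair_pmf (rgraph (insert x A) p) (rgraph (insert x A) q)) =
    do {a \<leftarrow> bernoulli_pmf p; g \<leftarrow> rgraph A p; b \<leftarrow> bernoulli_pmf q; h \<leftarrow> rgraph A q;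
        return_pmf ((\<lambda>e. g e \<or> h e)(x := a \<or> b))}"
    unfolding 1 pair_pmf_def map_pmf_def by (simp add: bind_assoc_pmf bind_return_pmf upd del: fun_upd_apply)
  \<comment> \<open>The draws of \<open>g\<close> and \<open>b\<close> are independent and may be
    exchanged, which brings the two answers for \<open>x\<close> together.\<close>
  also have "\<dots> = do {a \<leftarrow> bernoulli_pmf p; b \<leftarrow> bernoulli_pmf q; g \<leftarrow> rgraph A p; h \<leftarrow> rgraph A q;
        return_pmf ((\<lambda>e. g e \<or> h e)(x := a \<or> b))}"
    by (subst bind_commute_pmf) (rule refl)
  also have "\<dots> = rgraph (insert x A) r"
    unfolding 1 insert.IH bernoulli_or[OF assms(2-)]
    by (simp add: bind_assoc_pmf bind_return_pmf map_pmf_def pair_pmf_def)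
  finally show ?case ..
qed

section \<open>Balls, exploration and slow growth\<close>

text \<open>Normal form of an unordered pair, matching the pairs \<open>i < j\<close> of
  \<open>gnp_pairs\<close>.\<close>

definition edge :: "nat \<Rightarrow> nat \<Rightarrow> nat \<times> nat" where
  "edge u v = (min u v, max u v)"

lemma adj_edge: "adj G u v \<longleftrightarrow> u \<noteq> v \<and> G (edge u v)"
  by (auto simp: adj_def edge_def min_def max_def)

lemma adj_sym: "adj G u v \<longleftrightarrow> adj G v u"
  by (auto simp: adj_def)

lemma edge_commute: "edge u v = edge v u"
  by (simp add: edge_def min.commute max.commute)

lemma edge_eq_iff: "edge a b = edge u v \<longleftrightarrow> a = u \<and> b = v \<or> a = v \<and> b = u"
  by (auto simp: edge_def min_def max_def split: if_splits)

lemma edge_in_gnp_pairs: "edge u v \<in> gnp_pairs n \<longleftrightarrow> u < n \<and> v < n \<and> u \<noteq> v"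
  by (auto simp: edge_def gnp_pairs_def min_def max_def)

section \<open>Balls in a graph\<close>

primrec nball :: "('a \<Rightarrow> 'a \<Rightarrow> bool) \<Rightarrow> nat \<Rightarrow> 'a set \<Rightarrow> 'a set" where
  "nball R 0 T = T"
| "nball R (Suc j) T = nball R j T \<union> {w. \<exists>v\<in>nball R j T. R v w}"

lemma nball_Suc_inner: "nball R (Suc j) T = nball R j (nball R 1 T)"
  by (induction j) auto

lemma nball_add: "nball R (i + j) T = nball R i (nball R j T)"
  by (induction i) auto

lemma nball_mono: "S \<subseteq> T \<Longrightarrow> (\<And>u v. R u v \<Longrightarrow> R' u v) \<Longrightarrow> nball R j S \<subseteq> nball R' j T"
  by (induction j) (auto, blast)

lemma nball_increasing: "i \<le> j \<Longrightarrow> nball R i T \<subseteq> nball R j T"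
  by (rule lift_Suc_mono_le[of "\<lambda>j. nball R j T"]) auto

lemma nball_sym_mem:
  assumes "\<And>u v. R u v \<Longrightarrow> R v u" "w \<in> nball R j {v}"
  shows "v \<in> nball R j {w}"
  using assms(2)
proof (induction j arbitrary: w)
  case (Suc j)
  show ?case
  proof (cases "w \<in> nball R j {v}")
    case True
    then show ?thesis using Suc.IH by auto
  next
    case False
    then obtain u where u: "u \<in> nball R j {v}" "R u w" using Suc.prems by auto
    from Suc.IH[OF u(1)] have "v \<in> nball R j {u}" .
    also have "\<dots> \<subseteq> nball R j (nball R 1 {w})"
      by (rule nball_mono) (use assms(1)[OF u(2)] in auto)
    finally show ?thesis by (simp only: nball_Suc_inner)
  qed
qed simp

lemma nball_subset_closed:
  assumes "T \<subseteq> V" "\<And>u v. u \<in> V \<Longrightarrow> R u v \<Longrightarrow> v \<in> V"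
  shows "nball R j T \<subseteq> V"
  by (induction j) (use assms in auto)

text \<open>Each round adds a vertex unless the ball is already closed under
  \<open>R\<close>.\<close>

lemma nball_grows_or_closed:
  assumes "finite V" "v \<in> V" "\<And>u v. u \<in> V \<Longrightarrow> R u v \<Longrightarrow> v \<in> V"
  shows "card (nball R k {v}) > k \<or> (\<forall>u\<in>nball R k {v}. \<forall>w. R u w \<longrightarrow> w \<in> nball R k {v})"
proof (induction k)
  case (Suc k)
  have fin: "finite (nball R j {v})" for j
    using nball_subset_closed[of "{v}" V R j] assms finite_subset by blast
  show ?case
  proof (cases "\<forall>u\<in>nball R k {v}. \<forall>w. R u w \<longrightarrow> w \<in> nball R k {v}")
    case True
    then have "nball R (Suc k) {v} = nball R k {v}" by auto
    then show ?thesis using True by auto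
  next
    case False
    then have "nball R k {v} \<subset> nball R (Suc k) {v}" by auto
    then have "card (nball R k {v}) < card (nball R (Suc k) {v})"
      using fin psubset_card_mono by blast
    then show ?thesis using Suc False by auto
  qed
qed auto

lemma lipschitz_nball:
  assumes "v \<in> nball R j {u}" "u \<in> H" "\<And>x y. x \<in> H \<Longrightarrow> R x y \<Longrightarrow> y \<in> H \<and> \<bar>f x - f y\<bar> \<le> (1::real)"
  shows "v \<in> H \<and> \<bar>f v - f u\<bar> \<le> j"
  using assms(1)
proof (induction j arbitrary: v)
  case 0 then show ?case using assms(2) by simp
next
  case (Suc j)
  show ?case
  proof (cases "v \<in> nball R j {u}")
    case True
    then show ?thesis using Suc.IH by fastforce
  next
    case False
    then obtain w where w: "w \<in> nball R j {u}" "R w v" using Suc.prems by auto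
    then show ?thesis using Suc.IH[OF w(1)] assms(3)[OF _ w(2)] by fastforce
  qed
qed

text \<open>Unlike \<open>nball\<close>, each round of \<open>explore\<close> only looks at pairs between the current layer \<open>T\<close> and the
  unexplored set \<open>U\<close>, so different rounds use disjoint, hence independent, sets of pairs.\<close>

primrec explore :: "('a \<Rightarrow> 'a \<Rightarrow> bool) \<Rightarrow> nat \<Rightarrow> 'a set \<Rightarrow> 'a set \<Rightarrow> 'a set" where
  "explore R 0 T U = T"
| "explore R (Suc j) T U = T \<union> explore R j {u\<in>U. \<exists>v\<in>T. R v u} (U - {u\<in>U. \<exists>v\<in>T. R v u})"

text \<open>\<open>X\<close> collects the processed vertices, whose neighbours are all processed or
  in the current layer \<open>T\<close>. In the induction step the old layer joins \<open>X\<close>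
  and the newly found vertices become the layer.\<close>

lemma nball_subset_explore:
  assumes "\<And>x y. x \<in> X \<Longrightarrow> R x y \<Longrightarrow> y \<in> X \<union> T" "\<And>x y. R x y \<Longrightarrow> y \<in> X \<union> T \<union> U"
  shows "nball R j (X \<union> T) \<subseteq> X \<union> explore R j T U"
  using assms
proof (induction j arbitrary: X T U)
  case (Suc j)
  let ?D = "{u\<in>U. \<exists>v\<in>T. R v u}"
  have "nball R 1 (X \<union> T) \<subseteq> (X \<union> T) \<union> ?D"
    using Suc.prems by fastforce
  then have "nball R (Suc j) (X \<union> T) \<subseteq> nball R j ((X \<union> T) \<union> ?D)"
    unfolding nball_Suc_inner by (rule nball_mono)
  also have "\<dots> \<subseteq> (X \<union> T) \<union> explore R j ?D (U - ?D)"
    by (rule Suc.IH) (use Suc.prems in blast)+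
  finally show ?case by auto
qed auto

lemma explore_subset: "explore R j T U \<subseteq> T \<union> U"
proof (induction j arbitrary: T U)
  case (Suc j)
  have "explore R j {u\<in>U. \<exists>v\<in>T. R v u} (U - {u\<in>U. \<exists>v\<in>T. R v u}) \<subseteq> U"
    by (rule order_trans[OF Suc.IH]) auto
  then show ?case by auto
qed auto

lemma explore_cong:
  assumes "\<And>x y. x \<in> T \<union> U \<Longrightarrow> y \<in> U \<Longrightarrow> R x y = R' x y"
  shows "explore R j T U = explore R' j T U"
  using assms
proof (induction j arbitrary: T U)
  case (Suc j)
  have D: "{u\<in>U. \<exists>v\<in>T. R v u} = {u\<in>U. \<exists>v\<in>T. R' v u}" using Suc.prems by auto
  have "explore R j {u\<in>U. \<exists>v\<in>T. R' v u} (U - {u\<in>U. \<exists>v\<in>T. R' v u}) =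
    explore R' j {u\<in>U. \<exists>v\<in>T. R' v u} (U - {u\<in>U. \<exists>v\<in>T. R' v u})"
    by (rule Suc.IH) (use Suc.prems in auto)
  then show ?case unfolding explore.simps D by simp
qed auto

abbreviation restr :: "(nat \<times> nat) set \<Rightarrow> (nat \<times> nat \<Rightarrow> bool) \<Rightarrow> nat \<times> nat \<Rightarrow> bool" where
  "restr A g \<equiv> \<lambda>e. e \<in> A \<and> g e"

text \<open>Induction on the radius, revealing the pairs between \<open>T\<close> and
  \<open>U\<close> first. Given these, the induction hypothesis charges
  \<open>a = 2 * (4 * c) ^ j * \<theta>\<close> in the exponent to each new vertex. New vertices are
  at most as many as the edges found, whose exponential moment contributes at most
  \<open>2 * c * a = (4 * c) ^ Suc j * \<theta>\<close> per vertex of \<open>T\<close>. The vertex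
  itself contributes \<open>\<theta>\<close>, which the factor 2 absorbs.\<close>

lemma expectation_explore_le:
  fixes p c \<theta> :: real
  assumes c: "0 \<le> p" "p \<le> 1" "p * n \<le> c" "1 \<le> c"
    and "finite A" "T \<inter> U = {}" "finite T" "finite U" "card U \<le> n"
    and "0 \<le> \<theta>" "\<theta> * (4 * c) ^ j \<le> 1"
  shows "measure_pmf.expectation (rgraph A p) (\<lambda>g. exp (\<theta> * card (explore (adj (restr A g)) j T U)))
     \<le> exp (2 * (4 * c) ^ j * \<theta> * card T)"
  using assms(5-)
proof (induction j arbitrary: A T U)
  case 0
  have "exp (\<theta> * card T) \<le> exp (2 * \<theta> * card T)" using 0 by simp
  then show ?case by (simp add: mult.assoc)
next
  case (Suc j)
  let ?C = "4 * c"
  define A1 where "A1 = A \<inter> (\<lambda>(v, u). edge v u) ` (T \<times> U)"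
  define A2 where "A2 = A - A1"
  have fin: "finite A1" "finite A2" and A: "A = A1 \<union> A2" "A1 \<inter> A2 = {}"
    using Suc.prems by (auto simp: A1_def A2_def)
  define D where "D = (\<lambda>g. {u\<in>U. \<exists>v\<in>T. adj (restr A1 g) v u})"
  have cardA1: "real (card A1) \<le> n * card T"
  proof -
    have "card A1 \<le> card ((\<lambda>(v, u). edge v u) ` (T \<times> U))"
      unfolding A1_def using Suc.prems by (intro card_mono) auto
    also have "\<dots> \<le> card T * card U"
      using card_image_le[of "T \<times> U" "\<lambda>(v, u). edge v u"] Suc.prems by (simp add: card_cartesian_product)
    also have "\<dots> \<le> n * card T" using Suc.prems by (simp add: mult.commute)
    finally show ?thesis by (metis of_nat_le_iff of_nat_mult)
  qed
  have cardD: "card (D g) \<le> card {e\<in>A1. g e}" for g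
  proof -
    \<comment> \<open>Since \<open>T\<close> and \<open>U\<close> are disjoint, an edge between them
      determines its endpoint in \<open>U\<close>, so the new vertices lie in an image of the edges
      found.\<close>
    have "D g \<subseteq> (\<lambda>e. if fst e \<in> U then fst e else snd e) ` {e\<in>A1. g e}"
    proof
      fix u assume "u \<in> D g"
      then obtain v where v: "u \<in> U" "v \<in> T" "edge v u \<in> A1" "g (edge v u)"
        by (auto simp: D_def adj_edge)
      then have "u = (if fst (edge v u) \<in> U then fst (edge v u) else snd (edge v u))"
        using Suc.prems(2) by (auto simp: edge_def min_def max_def)
      then show "u \<in> (\<lambda>e. if fst e \<in> U then fst e else snd e) ` {e\<in>A1. g e}"
        using v by blast
    qed
    moreover have "finite {e\<in>A1. g e}" using fin(1) by simp
    ultimately show ?thesis by (rule surj_card_le[rotated])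
  qed
  have finD: "finite (D g)" for g using Suc.prems by (auto simp: D_def)
  \<comment> \<open>The remaining rounds stay inside \<open>U\<close>, and no pair of
    \<open>A1\<close> has both ends there; apart from the starting layer \<open>D g\<close> they
    depend on \<open>h\<close> alone.\<close>
  have step: "explore (adj (restr A (\<lambda>e. if e \<in> A1 then g e else h e))) (Suc j) T U
     = T \<union> explore (adj (restr A2 h)) j (D g) (U - D g)" (is "explore (adj ?m) _ _ _ = _") for g h
  proof -
    have D: "{u\<in>U. \<exists>v\<in>T. adj ?m v u} = D g"
      by (auto simp: D_def adj_edge A1_def)
    have "explore (adj ?m) j (D g) (U - D g) = explore (adj (restr A2 h)) j (D g) (U - D g)"
    proof (rule explore_cong)
      fix x y assume xy: "x \<in> D g \<union> (U - D g)" "y \<in> U - D g"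
      then have "edge x y \<notin> A1" using Suc.prems(2)
        by (auto simp: A1_def edge_eq_iff D_def)
      then show "adj ?m x y = adj (restr A2 h) x y"
        by (auto simp: adj_edge A2_def)
    qed
    then show ?thesis by (simp only: explore.simps D)
  qed
  have th1: "\<theta> * ?C ^ j \<le> 1"
  proof -
    have "?C ^ j \<le> ?C ^ Suc j" using c by (intro power_increasing) auto
    then have "\<theta> * ?C ^ j \<le> \<theta> * ?C ^ Suc j" using Suc.prems by (intro mult_left_mono) auto
    then show ?thesis using Suc.prems by linarith
  qed
  let ?a = "2 * ?C ^ j * \<theta>"
  have a0: "0 \<le> ?a" using c Suc.prems by auto
  \<comment> \<open>This allows \<open>exp a \<le> 1 + a + a^2\<close> below. The bound assumed on
    \<open>\<theta>\<close> supplies it, since \<open>?a * c\<close> is half of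
    \<open>\<theta> * (4 * c) ^ Suc j\<close>.\<close>
  have a1: "?a \<le> 1"
  proof -
    have "?a * c \<le> 1" using Suc.prems by (simp add: algebra_simps)
    moreover have "?a * 1 \<le> ?a * c" using a0 c by (intro mult_left_mono) auto
    ultimately show ?thesis by linarith
  qed
  have "measure_pmf.expectation (rgraph A p) (\<lambda>g. exp (\<theta> * card (explore (adj (restr A g)) (Suc j) T U)))
    = measure_pmf.expectation (rgraph A1 p) (\<lambda>g. measure_pmf.expectation (rgraph A2 p)
       (\<lambda>h. exp (\<theta> * card (T \<union> explore (adj (restr A2 h)) j (D g) (U - D g)))))"
    by (subst A(1), subst expectation_rgraph_Un[OF fin A(2)])
       (simp only: A(1)[symmetric] step)
  also have "\<dots> \<le> measure_pmf.expectation (rgraph A1 p) (\<lambda>g. exp (\<theta> * card T) * exp (?a * card {e\<in>A1. g e}))"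
  proof (intro integral_mono integrable_rgraph fin)
    fix g
    have "measure_pmf.expectation (rgraph A2 p)
       (\<lambda>h. exp (\<theta> * card (T \<union> explore (adj (restr A2 h)) j (D g) (U - D g))))
      \<le> measure_pmf.expectation (rgraph A2 p)
       (\<lambda>h. exp (\<theta> * card T) * exp (\<theta> * card (explore (adj (restr A2 h)) j (D g) (U - D g))))"
    proof (intro integral_mono integrable_rgraph fin)
      fix h
      have "card (T \<union> explore (adj (restr A2 h)) j (D g) (U - D g)) \<le>
          card T + card (explore (adj (restr A2 h)) j (D g) (U - D g))" by (rule card_Un_le)
      then have "\<theta> * card (T \<union> explore (adj (restr A2 h)) j (D g) (U - D g)) \<le>
          \<theta> * (card T + card (explore (adj (restr A2 h)) j (D g) (U - D g)))"
        using Suc.prems by (intro mult_left_mono) (auto simp flip: of_nat_add)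
      then show "exp (\<theta> * card (T \<union> explore (adj (restr A2 h)) j (D g) (U - D g))) \<le>
         exp (\<theta> * card T) * exp (\<theta> * card (explore (adj (restr A2 h)) j (D g) (U - D g)))"
        by (simp add: distrib_left flip: exp_add)
    qed
    also have "\<dots> = exp (\<theta> * card T) * measure_pmf.expectation (rgraph A2 p)
       (\<lambda>h. exp (\<theta> * card (explore (adj (restr A2 h)) j (D g) (U - D g))))"
      by simp
    also have "\<dots> \<le> exp (\<theta> * card T) * exp (2 * ?C ^ j * \<theta> * card (D g))"
    proof (intro mult_left_mono Suc.IH)
      show "card (U - D g) \<le> n" using Suc.prems card_mono[of U "U - D g"] by auto
    qed (use Suc.prems fin th1 finD in auto)
    also have "\<dots> \<le> exp (\<theta> * card T) * exp (?a * card {e\<in>A1. g e})"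
      using cardD[of g] a0 c Suc.prems by (intro mult_left_mono) (auto intro!: mult_left_mono)
    finally show "measure_pmf.expectation (rgraph A2 p)
       (\<lambda>h. exp (\<theta> * card (T \<union> explore (adj (restr A2 h)) j (D g) (U - D g))))
       \<le> exp (\<theta> * card T) * exp (?a * card {e\<in>A1. g e})" .
  qed
  also have "\<dots> = exp (\<theta> * card T) * measure_pmf.expectation (rgraph A1 p) (\<lambda>g. exp (?a * card {e\<in>A1. g e}))"
    by simp
  also have "\<dots> \<le> exp (\<theta> * card T) * exp (p * (exp ?a - 1) * card A1)"
    using expectation_rgraph_exp[OF fin(1) c(1,2) a0] by (intro mult_left_mono) auto
  also have "\<dots> \<le> exp (\<theta> * card T) * exp (2 * c * ?a * card T)"
  proof -
    have "exp ?a \<le> 1 + ?a + ?a^2" using a0 a1 by (intro exp_bound)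
    also have "\<dots> \<le> 1 + 2 * ?a"
      using a0 a1 mult_left_mono[OF a1 a0] by (simp add: power2_eq_square)
    finally have e: "exp ?a - 1 \<le> 2 * ?a" by simp
    have "p * (exp ?a - 1) * card A1 \<le> p * (2 * ?a) * (n * card T)"
      using e cardA1 c a0 by (intro mult_mono mult_left_mono) auto
    also have "\<dots> = (p * n) * (2 * ?a * card T)" by simp
    also have "\<dots> \<le> c * (2 * ?a * card T)" using a0 c by (intro mult_right_mono) auto
    finally show ?thesis by (simp add: mult_ac)
  qed
  also have "\<dots> = exp ((\<theta> + 2 * c * ?a) * card T)" by (simp add: algebra_simps flip: exp_add)
  also have "\<dots> \<le> exp (2 * ?C ^ Suc j * \<theta> * card T)"
  proof -
    have "1 \<le> ?C ^ Suc j" using c by (intro one_le_power) auto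
    then have "\<theta> * 1 \<le> \<theta> * ?C ^ Suc j" using Suc.prems by (intro mult_left_mono) auto
    moreover have "2 * c * ?a = ?C ^ Suc j * \<theta>" by simp
    ultimately have "\<theta> + 2 * c * ?a \<le> 2 * ?C ^ Suc j * \<theta>" by (simp add: mult.commute)
    then show ?thesis by (intro exp_mono mult_right_mono) auto
  qed
  finally show ?case .
qed

section \<open>Counting subsets, and elementary probability bounds\<close>

text \<open>Each counted set has weight \<open>x ^ card S \<ge> x ^ m\<close>, and the weights of
  all subsets of \<open>A\<close> add up to \<open>(1 + x) ^ card A\<close>.\<close>

lemma card_small_subsets_le:
  fixes x :: real
  assumes "finite A" "0 < x" "x \<le> 1"
  shows "card {S. S \<subseteq> A \<and> card S \<le> m} * x ^ m \<le> exp (x * card A)"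
proof -
  have "card {S. S \<subseteq> A \<and> card S \<le> m} * x ^ m = (\<Sum>S\<in>{S. S \<subseteq> A \<and> card S \<le> m}. x ^ m)"
    by simp
  also have "\<dots> \<le> (\<Sum>S\<in>{S. S \<subseteq> A \<and> card S \<le> m}. x ^ card S)"
    using assms by (intro sum_mono power_decreasing) auto
  also have "\<dots> \<le> (\<Sum>S\<in>Pow A. x ^ card S)"
    using assms by (intro sum_mono2) auto
  also have "\<dots> = (\<Prod>i\<in>A. x + 1)"
    using prod_add[OF assms(1), of "\<lambda>_. x" "\<lambda>_. 1"] by simp
  also have "\<dots> \<le> exp x ^ card A"
    using assms by (simp, intro power_mono) (auto simp: add.commute)
  also have "\<dots> = exp (x * card A)" by (simp add: exp_of_nat2_mult)
  finally show ?thesis .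
qed

text \<open>The choice \<open>x = t / card A\<close> turns the weighted count into the standard
  estimate of a binomial coefficient.\<close>

lemma card_subsets_le:
  fixes t :: nat
  assumes "finite A" "1 \<le> t" "t \<le> card A"
  shows "card {S. S \<subseteq> A \<and> card S = t} \<le> exp (t * (1 + ln (card A / t)))"
proof -
  define x where "x = real t / real (card A)"
  have x: "0 < x" "x \<le> 1" using assms(2,3) by (simp_all add: x_def)
  have xA: "x * card A = t" using assms(2,3) by (simp add: x_def)
  have "card {S. S \<subseteq> A \<and> card S = t} \<le> card {S. S \<subseteq> A \<and> card S \<le> t}"
    using assms(1) by (intro card_mono) auto
  then have "card {S. S \<subseteq> A \<and> card S = t} * x ^ t \<le> card {S. S \<subseteq> A \<and> card S \<le> t} * x ^ t"
    using x by (intro mult_right_mono) auto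
  also have "\<dots> \<le> exp t" using card_small_subsets_le[OF assms(1) x] unfolding xA .
  finally have "card {S. S \<subseteq> A \<and> card S = t} \<le> exp t / x ^ t"
    using x by (simp add: pos_le_divide_eq)
  also have "x ^ t = exp (t * ln x)" using x by (simp add: exp_of_nat_mult)
  also have "exp t / exp (t * ln x) = exp (t - t * ln x)" by (rule exp_diff[symmetric])
  also have "ln x = - ln (card A / t)" using assms(2,3) by (simp add: x_def ln_div)
  finally show ?thesis by (simp add: algebra_simps)
qed

lemma prob_pmf_markov:
  fixes f :: "'a \<Rightarrow> real"
  assumes "finite (set_pmf M)" "\<And>x. x \<in> set_pmf M \<Longrightarrow> 0 \<le> f x" "0 < a"
  shows "measure_pmf.prob M {x. a \<le> f x} \<le> measure_pmf.expectation M f / a"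
proof -
  have "a * measure_pmf.prob M {x. a \<le> f x} = measure_pmf.expectation M (\<lambda>x. a * indicator {x. a \<le> f x} x)"
    by simp
  also have "\<dots> \<le> measure_pmf.expectation M f"
    by (intro integral_mono_AE integrable_measure_pmf_finite assms(1) AE_pmfI)
       (use assms in \<open>auto simp: indicator_def\<close>)
  finally show ?thesis using assms(3) by (simp add: field_simps)
qed

lemma prob_pmf_Bex_le:
  assumes "finite I"
  shows "measure_pmf.prob M {x. \<exists>i\<in>I. P i x} \<le> (\<Sum>i\<in>I. measure_pmf.prob M {x. P i x})"
proof -
  have "{x. \<exists>i\<in>I. P i x} = (\<Union>i\<in>I. {x. P i x})" by auto
  then show ?thesis using measure_pmf.finite_measure_subadditive_finite[OF assms, of "\<lambda>i. {x. P i x}" M] by simp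
qed

lemma prob_pmf_mono_support:
  assumes "\<And>x. x \<in> set_pmf M \<Longrightarrow> P x \<Longrightarrow> Q x"
  shows "measure_pmf.prob M {x. P x} \<le> measure_pmf.prob M {x. Q x}"
  by (rule measure_pmf.finite_measure_mono_AE) (use assms in \<open>auto intro: AE_pmfI\<close>)

lemma prob_pmf_disj_le:
  "measure_pmf.prob M {x. P x \<or> Q x} \<le> measure_pmf.prob M {x. P x} + measure_pmf.prob M {x. Q x}"
  unfolding Collect_disj_eq by (rule measure_subadditive) auto

section \<open>Slow growth with high probability\<close>

text \<open>The geometric mean of \<open>card T\<close> and \<open>n\<close> appears because a union
  bound over all sets of \<open>t\<close> vertices costs \<open>t * (1 + ln (n / t))\<close> in the
  exponent, which is at most a constant times \<open>sqrt (t * n)\<close>.\<close>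

definition slow_growth :: "nat \<Rightarrow> real \<Rightarrow> (nat \<times> nat \<Rightarrow> bool) \<Rightarrow> bool" where
  "slow_growth n C G \<longleftrightarrow> (\<forall>T j. T \<subseteq> {..<n} \<longrightarrow> card (nball (adj G) j T) \<le> 4 * C ^ j * sqrt (card T * n))"

text \<open>Markov's inequality for the exponential moment of the exploration, with
  \<open>\<theta> = 1 / (4 * c) ^ j\<close>, the largest value allowed there.\<close>

lemma prob_nball_gt_le:
  fixes p c a :: real
  assumes c: "0 \<le> p" "p \<le> 1" "p * n \<le> c" "1 \<le> c" and T: "T \<subseteq> {..<n}"
  shows "measure_pmf.prob (gnp n p) {G. card (nball (adj G) j T) > (4 * c) ^ j * a} \<le> exp (2 * card T - a)"
proof -
  let ?A = "gnp_pairs n" and ?U = "{..<n} - T"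
  let ?\<theta> = "1 / (4 * c) ^ j"
  let ?E = "\<lambda>G. exp (?\<theta> * card (explore (adj (restr ?A G)) j T ?U))"
  have C: "0 < (4 * c) ^ j" using c by simp
  have finT: "finite T" using T finite_subset by blast
  have fin: "finite (set_pmf (rgraph ?A p))" by (intro finite_set_rgraph finite_gnp_pairs)
  have "measure_pmf.prob (rgraph ?A p) {G. card (nball (adj G) j T) > (4 * c) ^ j * a}
     \<le> measure_pmf.prob (rgraph ?A p) {G. exp a \<le> ?E G}"
  proof (rule prob_pmf_mono_support)
    fix G assume G: "G \<in> set_pmf (rgraph ?A p)" and *: "(4 * c) ^ j * a < card (nball (adj G) j T)"
    have GA: "restr ?A G = G" using set_rgraphD[OF finite_gnp_pairs G] by auto
    have "nball (adj G) j ({} \<union> T) \<subseteq> {} \<union> explore (adj G) j T ?U"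
    proof (rule nball_subset_explore)
      fix x y assume "adj G x y"
      then have "edge x y \<in> ?A" using set_rgraphD[OF finite_gnp_pairs G] by (auto simp: adj_edge)
      then show "y \<in> {} \<union> T \<union> ?U" by (auto simp: edge_in_gnp_pairs)
    qed auto
    then have "card (nball (adj G) j T) \<le> card (explore (adj (restr ?A G)) j T ?U)"
      unfolding GA using finT by (intro card_mono finite_subset[OF explore_subset]) auto
    then have "(4 * c) ^ j * a \<le> card (explore (adj (restr ?A G)) j T ?U)" using * by linarith
    then show "exp a \<le> ?E G" using C by (simp add: field_simps)
  qed
  also have "\<dots> \<le> measure_pmf.expectation (rgraph ?A p) ?E / exp a"
    by (rule prob_pmf_markov[OF fin]) auto
  also have "\<dots> \<le> exp (2 * (4 * c) ^ j * ?\<theta> * card T) / exp a"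
  proof (intro divide_right_mono expectation_explore_le[OF c finite_gnp_pairs])
    show "card ?U \<le> n" by (metis Diff_subset card_lessThan card_mono finite_lessThan)
  qed (use finT C c in auto)
  also have "\<dots> = exp (2 * card T - a)" using C c by (simp add: exp_diff)
  finally show ?thesis by (simp add: gnp_eq_rgraph)
qed

text \<open>The factor \<open>n * n\<close> counts radii and set sizes; for each size, the number of
  sets is outweighed by the tail bound for one set.\<close>

lemma prob_not_slow_growth_le:
  fixes p c :: real
  assumes c: "0 \<le> p" "p \<le> 1" "p * n \<le> c" "1 \<le> c" and n: "n \<ge> 1"
  shows "measure_pmf.prob (gnp n p) {G. \<not> slow_growth n (4 * c) G} \<le> n * n * exp (- sqrt n)"
proof -
  let ?P = "\<lambda>j T G. card (nball (adj G) j T) > (4 * c) ^ j * (4 * sqrt (card T * n))"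
  let ?S = "\<lambda>t. {T. T \<subseteq> {..<n} \<and> card T = t}"
  have finS: "finite (?S t)" for t by (rule finite_subset[of _ "Pow {..<n}"]) auto
  have "measure_pmf.prob (gnp n p) {G. \<not> slow_growth n (4 * c) G}
    \<le> measure_pmf.prob (gnp n p) {G. \<exists>j\<in>{..<n}. \<exists>t\<in>{1..n}. \<exists>T\<in>?S t. ?P j T G}"
  proof (rule prob_pmf_mono_support)
    fix G assume G: "G \<in> set_pmf (gnp n p)" and "\<not> slow_growth n (4 * c) G"
    then obtain T j where Tj: "T \<subseteq> {..<n}" "?P j T G" by (auto simp: slow_growth_def not_le mult_ac)
    have T0: "T \<noteq> {}"
    proof
      assume "T = {}"
      moreover have "nball (adj G) j {} = {}" by (induction j) auto
      ultimately show False using Tj by simp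
    qed
    then have t: "card T \<in> {1..n}"
      using Tj(1) by (metis One_nat_def Suc_leI atLeastAtMost_iff card_gt_0_iff card_lessThan card_mono finite_lessThan finite_subset)
    \<comment> \<open>Larger radii are harmless: the claimed bound is then at least
      \<open>2 ^ n > n\<close>.\<close>
    have "j < n"
    proof (rule ccontr)
      assume "\<not> j < n"
      have "nball (adj G) j T \<subseteq> {..<n}"
      proof (rule nball_subset_closed[OF Tj(1)])
        fix u v assume "adj G u v"
        then have "edge u v \<in> gnp_pairs n"
          using set_rgraphD[OF finite_gnp_pairs G[unfolded gnp_eq_rgraph]] by (auto simp: adj_edge)
        then show "v \<in> {..<n}" by (auto simp: edge_in_gnp_pairs)
      qed
      then have "card (nball (adj G) j T) \<le> n" by (metis card_lessThan card_mono finite_lessThan)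
      also have "n < 2 ^ n" by (rule less_exp)
      finally have "card (nball (adj G) j T) < (2::real) ^ n" by (metis of_nat_less_iff of_nat_numeral of_nat_power)
      also have "\<dots> \<le> 2 ^ j" using \<open>\<not> j < n\<close> by (intro power_increasing) auto
      also have "\<dots> \<le> (4 * c) ^ j" using c by (intro power_mono) auto
      also have "\<dots> * 1 \<le> (4 * c) ^ j * (4 * sqrt (card T * n))"
      proof (rule mult_left_mono)
        have "1 * 1 \<le> card T * n" using t n by (intro mult_mono) auto
        then have "1 \<le> real (card T * n)" by linarith
        then have "1 \<le> sqrt (card T * n)" by (rule real_sqrt_ge_one)
        then show "1 \<le> 4 * sqrt (card T * n)" by linarith
      qed (use c in auto)
      finally show False using Tj(2) by simp
    qed
    then show "\<exists>j\<in>{..<n}. \<exists>t\<in>{1..n}. \<exists>T\<in>?S t. ?P j T G" using Tj t by blast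
  qed
  also have "\<dots> \<le> (\<Sum>j<n. \<Sum>t\<in>{1..n}. \<Sum>T\<in>?S t. measure_pmf.prob (gnp n p) {G. ?P j T G})"
    by (intro order_trans[OF prob_pmf_Bex_le] sum_mono finS order_refl) auto
  also have "\<dots> \<le> (\<Sum>j<n. \<Sum>t\<in>{1..n}. exp (- sqrt n))"
  proof (intro sum_mono)
    fix j t assume t: "t \<in> {1..n}"
    have "(\<Sum>T\<in>?S t. measure_pmf.prob (gnp n p) {G. ?P j T G}) \<le> (\<Sum>T\<in>?S t. exp (2 * t - 4 * sqrt (t * n)))"
    proof (rule sum_mono)
      fix T assume "T \<in> ?S t"
      then show "measure_pmf.prob (gnp n p) {G. ?P j T G} \<le> exp (2 * t - 4 * sqrt (t * n))"
        using prob_nball_gt_le[OF c, of T j "4 * sqrt (t * n)"] by auto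
    qed
    also have "\<dots> = card (?S t) * exp (2 * t - 4 * sqrt (t * n))" by simp
    also have "\<dots> \<le> exp (t * (1 + ln (n / t))) * exp (2 * t - 4 * sqrt (t * n))"
      using card_subsets_le[of "{..<n}" t] t by (intro mult_right_mono) auto
    also have "\<dots> = exp (t * (3 + ln (n / t)) - 4 * sqrt (t * n))"
      by (simp add: algebra_simps flip: exp_add)
    also have "\<dots> \<le> exp (- sqrt n)"
    proof -
      \<comment> \<open>With \<open>r = n / t\<close> the point is
        \<open>3 + ln r \<le> 3 * sqrt r\<close> for \<open>r \<ge> 1\<close>; of the four multiples
        of \<open>sqrt (t * n)\<close>, one is left over.\<close>
      define r where "r = real n / real t"
      have r: "r \<ge> 1" using t by (auto simp: r_def)
      then have r1: "1 \<le> sqrt r" by (rule real_sqrt_ge_one)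
      have "ln r = 2 * ln (sqrt r)" using r by (simp add: ln_sqrt)
      also have "\<dots> \<le> 2 * (sqrt r - 1)" using r1 by (intro mult_left_mono ln_le_minus_one) linarith+
      finally have "3 + ln r \<le> 3 * sqrt r" using r1 by argo
      then have "t * (3 + ln r) \<le> t * (3 * sqrt r)" by (intro mult_left_mono) auto
      also have "t * (3 * sqrt r) = 3 * sqrt (t * n)"
      proof -
        have "t * sqrt r = sqrt (t\<^sup>2) * sqrt r" by simp
        also have "\<dots> = sqrt (t\<^sup>2 * r)" by (rule real_sqrt_mult[symmetric])
        also have "real (t\<^sup>2) * r = t * n" using t by (simp add: power2_eq_square r_def)
        finally show ?thesis by (simp add: r_def)
      qed
      finally have "t * (3 + ln r) - 4 * sqrt (t * n) \<le> - sqrt (t * n)" by linarith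
      also have "\<dots> \<le> - sqrt n"
      proof -
        have "n \<le> t * n" using t by simp
        then show ?thesis by (metis neg_le_iff_le of_nat_le_iff real_sqrt_le_iff)
      qed
      finally show ?thesis by (simp add: r_def)
    qed
    finally show "(\<Sum>T\<in>?S t. measure_pmf.prob (gnp n p) {G. ?P j T G}) \<le> exp (- sqrt n)" .
  qed
  also have "\<dots> = real n * real n * exp (- sqrt n)" by simp
  finally show ?thesis .
qed

section \<open>Depth-first search finds a long path\<close>

definition has_path :: "nat \<Rightarrow> (nat \<times> nat \<Rightarrow> bool) \<Rightarrow> nat \<Rightarrow> bool" where
  "has_path n G l \<longleftrightarrow> (\<exists>P. distinct P \<and> set P \<subseteq> {..<n} \<and> length P = l \<and> successively (adj G) P)"

text \<open>Reveals the single pair \<open>e\<close>; this models one query of the search.\<close>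

lemma prob_rgraph_insert:
  assumes "finite A" "e \<notin> A" "0 \<le> p" "p \<le> 1"
  shows "measure_pmf.prob (rgraph (insert e A) p) {g. Q g} =
    p * measure_pmf.prob (rgraph A p) {g. Q (g(e := True))} +
    (1 - p) * measure_pmf.prob (rgraph A p) {g. Q (g(e := False))}"
proof -
  have "rgraph (insert e A) p = map_pmf (\<lambda>(y, f). f(e := y)) (pair_pmf (bernoulli_pmf p) (rgraph A p))"
    unfolding rgraph_def using assms by (simp add: Pi_pmf_insert)
  then have "measure_pmf.prob (rgraph (insert e A) p) {g. Q g} =
     measure_pmf.prob (pair_pmf (bernoulli_pmf p) (rgraph A p)) {x. Q ((snd x)(e := fst x))}"
    by (simp add: case_prod_unfold vimage_def)
  also have "\<dots> = measure_pmf.expectation (pair_pmf (bernoulli_pmf p) (rgraph A p))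
      (indicator {x. Q ((snd x)(e := fst x))})" by simp
  also have "\<dots> = measure_pmf.expectation (bernoulli_pmf p) (\<lambda>b. measure_pmf.expectation (rgraph A p)
      (\<lambda>g. indicator {x. Q ((snd x)(e := fst x))} (b, g)))"
    by (rule expectation_pair_finite) (auto simp: finite_set_rgraph assms)
  also have "\<dots> = measure_pmf.expectation (bernoulli_pmf p) (\<lambda>b. measure_pmf.prob (rgraph A p) {g. Q (g(e := b))})"
  proof -
    have "(\<lambda>g. indicator {x. Q ((snd x)(e := fst x))} (b, g) :: real) = indicator {g. Q (g(e := b))}" for b
      by (auto simp: indicator_def)
    then show ?thesis by simp
  qed
  also have "\<dots> = p * measure_pmf.prob (rgraph A p) {g. Q (g(e := True))} +
    (1 - p) * measure_pmf.prob (rgraph A p) {g. Q (g(e := False))}"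
    using assms by (simp add: mult.commute)
  finally show ?thesis .
qed

text \<open>Effect of one query on the Chernoff bound. A present edge uses up one factor
  \<open>1 / y\<close>, so the two answers combine to
  \<open>p * y + (1 - p) = 1 - p * (1 - y)\<close>. For \<open>r = 0\<close> the truncated exponent
  does not drop, and it suffices that this number is at most 1.\<close>

lemma chernoff_step:
  fixes p y :: real
  assumes "0 \<le> p" "p \<le> 1" "0 < y" "y \<le> 1"
  shows "p * ((1 - p * (1 - y)) ^ (r - 1) * (1 / y) ^ m) + (1 - p) * ((1 - p * (1 - y)) ^ (r - 1) * (1 / y) ^ Suc m)
    \<le> (1 - p * (1 - y)) ^ r * (1 / y) ^ Suc m"
proof -
  let ?a = "1 - p * (1 - y)"
  have a: "0 \<le> ?a" "?a \<le> 1" using assms mult_le_one[of p "1 - y"] by auto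
  have "p * (?a ^ (r - 1) * (1 / y) ^ m) + (1 - p) * (?a ^ (r - 1) * (1 / y) ^ Suc m)
     = ?a ^ (r - 1) * ?a * (1 / y) ^ Suc m"
    using assms by (simp add: field_simps)
  also have "\<dots> \<le> ?a ^ r * (1 / y) ^ Suc m"
  proof (intro mult_right_mono, cases r)
    case 0 then show "?a ^ (r - 1) * ?a \<le> ?a ^ r" using a by simp
  next
    case (Suc k) then show "?a ^ (r - 1) * ?a \<le> ?a ^ r" by (simp add: mult.commute)
  qed (use assms in auto)
  finally show ?thesis .
qed

text \<open>State of the depth-first search: \<open>P\<close> is the stack, \<open>S\<close> the finished and \<open>U\<close> the unvisited
  vertices; the pairs in \<open>F\<close> have not been queried yet, and \<open>K\<close> records the answers so far. If the
  stack stays shorter than \<open>l\<close> until \<open>s\<close> vertices are visited, then at least \<open>(s - l) * (n - s)\<close>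
  queries produced at most \<open>s\<close> edges; the bound is the Chernoff bound for this event.\<close>

lemma prob_no_path_dfs:
  fixes p y :: real
  assumes p: "0 \<le> p" "p \<le> 1" and y: "0 < y" "y \<le> 1" and "s \<le> n"
    and "F \<subseteq> gnp_pairs n" "distinct P" "S \<inter> set P = {}" "U \<inter> (S \<union> set P) = {}"
    and "S \<union> set P \<union> U = {..<n}" "card S + length P \<le> s" "length P \<le> l"
    and "\<And>v u. v \<in> S \<Longrightarrow> u \<in> U \<Longrightarrow> edge v u \<notin> F"
    and "successively (\<lambda>u v. u \<noteq> v \<and> edge u v \<notin> F \<and> K (edge u v)) P"
  shows "measure_pmf.prob (rgraph F p) {g. \<not> has_path n (\<lambda>e. if e \<in> F then g e else K e) l}
    \<le> (1 - p * (1 - y)) ^ ((s - l) * (n - s) - (card (gnp_pairs n) - card F)) * (1 / y) ^ (s - (card S + length P))"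
  using assms(6-)
\<comment> \<open>Each move lowers this measure: a query shrinks \<open>F\<close>, a finished vertex
  leaves the stack, and pushing a vertex of \<open>U\<close> subtracts 2 and adds 1.\<close>
proof (induction "card F + length P + 2 * card U" arbitrary: F P S U K rule: less_induct)
  case less
  let ?a = "1 - p * (1 - y)" and ?N = "card (gnp_pairs n)" and ?t0 = "(s - l) * (n - s)"
  have a: "0 \<le> ?a" "?a \<le> 1" using p y mult_le_one[of p "1 - y"] by auto
  have finU: "finite U" "finite S" 
    using less.prems(5) by (metis finite_Un finite_lessThan)+
  have finF: "finite F" using less.prems(1) finite_gnp_pairs finite_subset by blast
  have cards: "card S + length P + card U = n"
  proof -
    have "card (S \<union> set P \<union> U) = card S + card (set P) + card U"
      using less.prems(3,4) finU by (subst card_Un_disjoint) (auto simp: card_Un_disjoint)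
    then show ?thesis using less.prems(2,5) by (simp add: distinct_card)
  qed
  consider "length P = l" | "length P < l" "card S + length P = s" | "length P < l" "card S + length P < s"
    using less.prems by linarith
  then show ?case
  proof cases
    \<comment> \<open>A stack of \<open>l\<close> vertices is itself the required path, whatever the
      open pairs turn out to be.\<close>
    case 1
    have "has_path n (\<lambda>e. if e \<in> F then g e else K e) l" for g
      unfolding has_path_def
    proof (intro exI[of _ P] conjI)
      show "successively (adj (\<lambda>e. if e \<in> F then g e else K e)) P"
        using less.prems(9) by (rule successively_mono) (auto simp: adj_edge)
    qed (use 1 less.prems in auto)
    then have "measure_pmf.prob (rgraph F p) {g. \<not> has_path n (\<lambda>e. if e \<in> F then g e else K e) l} = 0"
      by simp
    then show ?thesis using a y by (auto intro!: mult_nonneg_nonneg)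
  next
    \<comment> \<open>At least \<open>s - l\<close> vertices are finished, \<open>n - s\<close> are
      unvisited, and all pairs between them have been queried. So both exponents have run down to 0
      and the bound is 1.\<close>
    case 2
    have "(s - l) * (n - s) \<le> card S * card U"
      using 2 cards by (intro mult_mono) auto
    also have "\<dots> = card ((\<lambda>(v, u). edge v u) ` (S \<times> U))"
    proof -
      have "inj_on (\<lambda>(v, u). edge v u) (S \<times> U)"
        using less.prems(4) by (auto simp: inj_on_def edge_eq_iff)
      then show ?thesis by (simp add: card_image card_cartesian_product)
    qed
    also have "\<dots> \<le> card (gnp_pairs n - F)"
    proof (rule card_mono)
      show "(\<lambda>(v, u). edge v u) ` (S \<times> U) \<subseteq> gnp_pairs n - F"
        using less.prems(4,5,8) by (auto simp: edge_in_gnp_pairs)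
    qed (simp add: finite_gnp_pairs)
    also have "\<dots> = ?N - card F" using less.prems(1) finF by (simp add: card_Diff_subset)
    finally have "?t0 - (?N - card F) = 0" by simp
    then show ?thesis using 2 by simp
  next
    case 3
    then have "U \<noteq> {}" using cards \<open>s \<le> n\<close> by auto
    show ?thesis
    proof (cases P)
      \<comment> \<open>With an empty stack any unvisited vertex starts a new tree; visiting it
        without an edge only gives away a factor \<open>1 / y \<ge> 1\<close>.\<close>
      case Nil
      obtain u where u: "u \<in> U" using \<open>U \<noteq> {}\<close> by blast
      have "measure_pmf.prob (rgraph F p) {g. \<not> has_path n (\<lambda>e. if e \<in> F then g e else K e) l}
        \<le> ?a ^ (?t0 - (?N - card F)) * (1 / y) ^ (s - (card S + length [u]))"
      proof (rule less.hyps[where U = "U - {u}"])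
        have "card U > 0" using u finU card_gt_0_iff by blast
        then show "card F + length [u] + 2 * card (U - {u}) < card F + length P + 2 * card U"
          using Nil u finU by (simp add: card_Diff_singleton)
      qed (use less.prems Nil u 3 in auto)
      also have "\<dots> \<le> ?a ^ (?t0 - (?N - card F)) * (1 / y) ^ (s - (card S + length P))"
        using a y Nil by (intro mult_left_mono power_increasing) auto
      finally show ?thesis .
    next
      case (Cons v P')
      show ?thesis
      proof (cases "\<exists>x\<in>U. edge v x \<in> F")
        case True
        then obtain x where x: "x \<in> U" "edge v x \<in> F" by blast
        define F' where "F' = F - {edge v x}"
        let ?e = "edge v x"
        have F: "F = insert ?e F'" "?e \<notin> F'" "finite F'" using x finF by (auto simp: F'_def)
        have vx: "v \<noteq> x" using less.prems(4) x Cons by auto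
        have cF: "card F = Suc (card F')" using F by (metis card_insert_disjoint)
        have cN: "card F \<le> ?N" using less.prems(1) by (simp add: card_mono finite_gnp_pairs)
        obtain m where m: "s - (card S + length P) = Suc m" using 3 by (metis Suc_diff_Suc)
        define r where "r = ?t0 - (?N - card F)"
        have r: "?t0 - (?N - card F') = r - 1" using cF cN by (simp add: r_def)
        \<comment> \<open>The answer \<open>b\<close> moves from the open pairs to the record
          \<open>K\<close>; the graph stays the same.\<close>
        have graph: "(\<lambda>e. if e \<in> F then (g(?e := b)) e else K e) = (\<lambda>e. if e \<in> F' then g e else (K(?e := b)) e)" for g b
          using F by auto
        have suc: "successively (\<lambda>u w. u \<noteq> w \<and> edge u w \<notin> F' \<and> (K(?e := b)) (edge u w)) P" for b
          using less.prems(9) by (rule successively_mono) (use F in auto)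
        have T: "measure_pmf.prob (rgraph F' p) {g. \<not> has_path n (\<lambda>e. if e \<in> F' then g e else (K(?e := True)) e) l}
          \<le> ?a ^ (?t0 - (?N - card F')) * (1 / y) ^ (s - (card S + length (x # P)))"
        proof (rule less.hyps[where U = "U - {x}"])
          have "card U > 0" using x finU card_gt_0_iff by blast
          then show "card F' + length (x # P) + 2 * card (U - {x}) < card F + length P + 2 * card U"
            using x finU cF by (simp add: card_Diff_singleton)
          show "successively (\<lambda>u w. u \<noteq> w \<and> edge u w \<notin> F' \<and> (K(?e := True)) (edge u w)) (x # P)"
            using suc[of True] Cons vx F by (auto simp: edge_commute)
        qed (use less.prems x 3 F in auto)
        have Fa: "measure_pmf.prob (rgraph F' p) {g. \<not> has_path n (\<lambda>e. if e \<in> F' then g e else (K(?e := False)) e) l}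
          \<le> ?a ^ (?t0 - (?N - card F')) * (1 / y) ^ (s - (card S + length P))"
          by (rule less.hyps[where U = "U"]) (use less.prems suc[of False] F cF in auto)
        have "measure_pmf.prob (rgraph F p) {g. \<not> has_path n (\<lambda>e. if e \<in> F then g e else K e) l}
          = p * measure_pmf.prob (rgraph F' p) {g. \<not> has_path n (\<lambda>e. if e \<in> F' then g e else (K(?e := True)) e) l}
          + (1 - p) * measure_pmf.prob (rgraph F' p) {g. \<not> has_path n (\<lambda>e. if e \<in> F' then g e else (K(?e := False)) e) l}"
          using prob_rgraph_insert[OF F(3,2) p, where Q = "\<lambda>g. \<not> has_path n (\<lambda>e. if e \<in> F then g e else K e) l"]
          unfolding graph F(1)[symmetric] .
        also have "\<dots> \<le> p * (?a ^ (r - 1) * (1 / y) ^ m) + (1 - p) * (?a ^ (r - 1) * (1 / y) ^ Suc m)"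
        proof -
          have "s - (card S + length (x # P)) = m" using m by simp
          then show ?thesis using T Fa p unfolding r m by (intro add_mono mult_left_mono) simp_all
        qed
        also have "\<dots> \<le> ?a ^ r * (1 / y) ^ Suc m" by (rule chernoff_step[OF p y])
        finally show ?thesis unfolding r_def m .
      next
        \<comment> \<open>All pairs from the top of the stack to \<open>U\<close> have been queried,
          so the top vertex is finished and moves to \<open>S\<close>.\<close>
        case False
        have "measure_pmf.prob (rgraph F p) {g. \<not> has_path n (\<lambda>e. if e \<in> F then g e else K e) l}
          \<le> ?a ^ (?t0 - (?N - card F)) * (1 / y) ^ (s - (card (insert v S) + length P'))"
        proof (rule less.hyps[where U = U])
          show "successively (\<lambda>u w. u \<noteq> w \<and> edge u w \<notin> F \<and> K (edge u w)) P'"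
            using less.prems(9) Cons by (auto simp: successively_Cons)
          show "card (insert v S) + length P' \<le> s" using less.prems Cons finU by auto
        qed (use less.prems Cons False in auto)
        moreover have "card (insert v S) + length P' = card S + length P"
          using less.prems Cons finU by auto
        ultimately show ?thesis by simp
      qed
    qed
  qed
qed

lemma prob_no_path_le:
  fixes p y :: real
  assumes p: "0 \<le> p" "p \<le> 1" and y: "0 < y" "y \<le> 1" and "s \<le> n"
  shows "measure_pmf.prob (gnp n p) {G. \<not> has_path n G l}
    \<le> (1 - p * (1 - y)) ^ ((s - l) * (n - s)) * (1 / y) ^ s"
proof -
  have "measure_pmf.prob (rgraph (gnp_pairs n) p) {G. \<not> has_path n G l}
    \<le> measure_pmf.prob (rgraph (gnp_pairs n) p) {g. \<not> has_path n (\<lambda>e. if e \<in> gnp_pairs n then g e else False) l}"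
  proof (rule prob_pmf_mono_support)
    fix G assume "G \<in> set_pmf (rgraph (gnp_pairs n) p)" "\<not> has_path n G l"
    moreover from this have "(\<lambda>e. if e \<in> gnp_pairs n then G e else False) = G"
      using set_rgraphD[OF finite_gnp_pairs] by fastforce
    ultimately show "\<not> has_path n (\<lambda>e. if e \<in> gnp_pairs n then G e else False) l" by simp
  qed
  also have "\<dots> \<le> (1 - p * (1 - y)) ^ ((s - l) * (n - s) - (card (gnp_pairs n) - card (gnp_pairs n))) * (1 / y) ^ (s - (card ({} :: nat set) + length ([] :: nat list)))"
    by (rule prob_no_path_dfs[OF p y \<open>s \<le> n\<close>, where U = "{..<n}"]) auto
  finally show ?thesis by (simp add: gnp_eq_rgraph)
qed

section \<open>Expansion of a sprinkled path\<close>

definition outer_boundary :: "(nat \<times> nat \<Rightarrow> bool) \<Rightarrow> nat set \<Rightarrow> nat set \<Rightarrow> nat set" where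
  "outer_boundary G Q T = {u \<in> Q - T. \<exists>v\<in>T. adj G v u}"

text \<open>The logarithm compensates entropy: the sets of \<open>t\<close> path vertices with at
  most about \<open>t / (1 + ln (n / t))\<close> flips are only exponentially many in
  \<open>t\<close>, which the sprinkled edges leaving \<open>t\<close> vertices can beat.\<close>

definition expanding :: "nat \<Rightarrow> real \<Rightarrow> real \<Rightarrow> nat set \<Rightarrow> (nat \<times> nat \<Rightarrow> bool) \<Rightarrow> bool" where
  "expanding n \<eta> \<phi> Q G \<longleftrightarrow> (\<forall>T. T \<subseteq> Q \<longrightarrow> T \<noteq> {} \<longrightarrow> real (card T) \<le> (1 - \<eta>) * real (card Q) \<longrightarrow>
     \<phi> * real (card T) \<le> card (outer_boundary G Q T) * (1 + ln (n / card T)))"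

text \<open>A subset of a path is determined by its flips along the path and by whether it contains the
  first vertex.\<close>

definition flips :: "'a list \<Rightarrow> 'a set \<Rightarrow> nat set" where
  "flips Q T = {i. Suc i < length Q \<and> (Q ! i \<in> T) \<noteq> (Q ! Suc i \<in> T)}"

lemma flips_determine:
  assumes "flips Q S = flips Q T" "Q ! 0 \<in> S \<longleftrightarrow> Q ! 0 \<in> T" "i < length Q"
  shows "Q ! i \<in> S \<longleftrightarrow> Q ! i \<in> T"
  using assms(3)
proof (induction i)
  case 0 then show ?case using assms(2) by simp
next
  case (Suc i)
  then have "Q ! i \<in> S \<longleftrightarrow> Q ! i \<in> T" by simp
  moreover have "i \<in> flips Q S \<longleftrightarrow> i \<in> flips Q T" using assms(1) by simp
  ultimately show ?case using Suc.prems by (auto simp: flips_def)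
qed

text \<open>Without flips, \<open>T\<close> would agree along the path with \<open>set Q\<close> or
  with the empty set, depending on the first vertex.\<close>

lemma flips_nonempty:
  assumes "T \<subseteq> set Q" "T \<noteq> {}" "T \<noteq> set Q"
  shows "flips Q T \<noteq> {}"
proof
  assume *: "flips Q T = {}"
  show False
  proof (cases "Q ! 0 \<in> T")
    case True
    have "flips Q (set Q) = {}" by (auto simp: flips_def)
    then have "Q ! i \<in> T" if "i < length Q" for i
      using flips_determine[of Q T "set Q" i] * True that nth_mem[of 0 Q] nth_mem[OF that] by fastforce
    then have "set Q \<subseteq> T" by (auto simp: in_set_conv_nth)
    then show False using assms by blast
  next
    case False
    have "flips Q {} = {}" by (auto simp: flips_def)
    then have "Q ! i \<notin> T" if "i < length Q" for i
      using flips_determine[of Q T "{}" i] * False that by auto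
    then have "set Q \<inter> T = {}" by (auto simp: in_set_conv_nth)
    then show False using assms by blast
  qed
qed

lemma card_few_flips_le:
  "card {T. T \<subseteq> set Q \<and> card (flips Q T) \<le> m} \<le> 2 * card {S. S \<subseteq> {..<length Q} \<and> card S \<le> m}"
proof -
  let ?f = "\<lambda>T. (Q ! 0 \<in> T, flips Q T)"
  let ?B = "(UNIV :: bool set) \<times> {S. S \<subseteq> {..<length Q} \<and> card S \<le> m}"
  have "inj_on ?f {T. T \<subseteq> set Q \<and> card (flips Q T) \<le> m}"
  proof (rule inj_onI)
    fix S T assume "S \<in> {T. T \<subseteq> set Q \<and> card (flips Q T) \<le> m}" "T \<in> {T. T \<subseteq> set Q \<and> card (flips Q T) \<le> m}"
      and eq: "?f S = ?f T"
    then have sub: "S \<subseteq> set Q" "T \<subseteq> set Q" by auto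
    have "Q ! i \<in> S \<longleftrightarrow> Q ! i \<in> T" if "i < length Q" for i
      using flips_determine[of Q S T i] eq that by auto
    then have "x \<in> S \<longleftrightarrow> x \<in> T" if "x \<in> set Q" for x using that by (auto simp: in_set_conv_nth)
    then show "S = T" using sub by blast
  qed
  moreover have "?f ` {T. T \<subseteq> set Q \<and> card (flips Q T) \<le> m} \<subseteq> ?B"
    by (auto simp: flips_def)
  moreover have "finite ?B" by (intro finite_cartesian_product finite_subset[of "{S. S \<subseteq> {..<length Q} \<and> card S \<le> m}" "Pow {..<length Q}"]) auto
  ultimately have "card {T. T \<subseteq> set Q \<and> card (flips Q T) \<le> m} \<le> card ?B"
    by (rule card_inj_on_le)
  also have "card ?B = 2 * card {S. S \<subseteq> {..<length Q} \<and> card S \<le> m}"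
    by (simp add: card_cartesian_product)
  finally show ?thesis .
qed

text \<open>Each flip is a path edge whose end outside \<open>T\<close> is a boundary vertex. A
  vertex is the left end of at most one path edge and the right end of at most one, hence the factor
  2.\<close>

lemma card_flips_le:
  assumes "distinct Q" "successively (adj G) Q"
  shows "card (flips Q T) \<le> 2 * card (outer_boundary G (set Q) T)"
proof -
  let ?B = "outer_boundary G (set Q) T"
  let ?I = "{i. i < length Q \<and> Q ! i \<in> ?B}" and ?J = "{i. Suc i < length Q \<and> Q ! Suc i \<in> ?B}"
  have finB: "finite ?B" by (simp add: outer_boundary_def)
  have "flips Q T \<subseteq> ?I \<union> ?J"
  proof
    fix i assume i: "i \<in> flips Q T"
    then have "adj G (Q ! i) (Q ! Suc i)"
      using assms(2) by (auto simp: flips_def successively_conv_nth)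
    then show "i \<in> ?I \<union> ?J"
      using i adj_sym[of G "Q ! i" "Q ! Suc i"] by (auto simp: flips_def outer_boundary_def)
  qed
  then have "card (flips Q T) \<le> card (?I \<union> ?J)"
    by (intro card_mono finite_subset[of "?I \<union> ?J" "{..<length Q}"]) auto
  also have "\<dots> \<le> card ?I + card ?J" by (rule card_Un_le)
  also have "card ?I \<le> card ?B"
    using assms(1) finB by (intro card_inj_on_le[of "\<lambda>i. Q ! i"]) (auto simp: inj_on_def nth_eq_iff_index_eq)
  also have "card ?J \<le> card ?B"
    using assms(1) finB by (intro card_inj_on_le[of "\<lambda>i. Q ! Suc i"]) (auto simp: inj_on_def nth_eq_iff_index_eq)
  finally show ?thesis by simp
qed

text \<open>If the boundary is exactly \<open>B\<close>, no sprinkled edge joins \<open>T\<close> to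
  \<open>Q - T - B\<close>, whatever the fixed graph \<open>g\<close> is.\<close>

lemma prob_boundary_eq_le:
  assumes p: "0 \<le> p" "p \<le> 1" and Q: "Q \<subseteq> {..<n}" "T \<subseteq> Q" "B \<subseteq> Q"
  shows "measure_pmf.prob (gnp n p) {h. outer_boundary (\<lambda>e. g e \<or> h e) Q T = B} \<le> (1 - p) ^ (card T * (card Q - card T - card B))"
proof -
  let ?E = "(\<lambda>(v, u). edge v u) ` (T \<times> (Q - T - B))"
  have fin: "finite Q" "finite T" "finite B"
    using Q finite_subset[OF Q(1)] finite_subset[of T Q] finite_subset[of B Q] by auto
  have "measure_pmf.prob (gnp n p) {h. outer_boundary (\<lambda>e. g e \<or> h e) Q T = B} \<le> measure_pmf.prob (gnp n p) {h. \<forall>e\<in>?E. \<not> h e}"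
  proof (rule measure_pmf.finite_measure_mono)
    show "{h. outer_boundary (\<lambda>e. g e \<or> h e) Q T = B} \<subseteq> {h. \<forall>e\<in>?E. \<not> h e}"
      by (auto simp: outer_boundary_def adj_edge) metis
  qed auto
  also have "\<dots> = (1 - p) ^ card ?E"
  proof -
    have "v < n \<and> u < n \<and> v \<noteq> u" if "v \<in> T" "u \<in> Q - T - B" for v u using Q that by blast
    then show ?thesis unfolding gnp_eq_rgraph using p
      by (intro prob_rgraph_none finite_gnp_pairs) (auto simp: edge_in_gnp_pairs)
  qed
  also have "\<dots> \<le> (1 - p) ^ (card T * (card Q - card T - card B))"
  proof (rule power_decreasing)
    have "inj_on (\<lambda>(v, u). edge v u) (T \<times> (Q - T - B))" by (auto simp: inj_on_def edge_eq_iff)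
    then have "card ?E = card T * card (Q - T - B)" by (simp add: card_image card_cartesian_product)
    moreover have "card Q - card T - card B \<le> card (Q - T - B)"
      using fin by (metis diff_card_le_card_Diff diff_le_mono le_trans)
    ultimately show "card T * (card Q - card T - card B) \<le> card ?E" by simp
  qed (use p in auto)
  finally show ?thesis .
qed

text \<open>Union bound over the size \<open>t\<close>, the set \<open>T\<close> and its boundary
  \<open>B\<close>. Sprinkling gives the decay rate
  \<open>\<epsilon> * \<gamma> * \<eta> / 2\<close> per vertex of \<open>T\<close>; of this,
  \<open>2 * \<delta> + 3 * \<phi> * (1 + ln (1 / \<delta>))\<close> pays for counting
  \<open>T\<close> and \<open>B\<close>, and at least \<open>\<rho>\<close> remains.\<close>

lemma prob_not_expanding_le:
  fixes \<epsilon> \<gamma> \<eta> \<phi> \<delta> \<rho> p :: real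
  assumes p: "\<epsilon> / n \<le> p" "p \<le> 1" "0 < \<epsilon>" and \<eta>: "0 < \<eta>" and \<phi>: "0 < \<phi>" "\<phi> \<le> \<eta> / 2" "\<phi> \<le> 1"
    and \<delta>: "0 < \<delta>" "\<delta> \<le> 1" and \<rho>: "0 < \<rho>" "2 * \<delta> + 3 * \<phi> * (1 + ln (1 / \<delta>)) + \<rho> \<le> \<epsilon> * \<gamma> * \<eta> / 2"
    and Q: "distinct Q" "set Q \<subseteq> {..<n}" "successively (adj g) Q" "\<gamma> * n \<le> length Q" and n: "1 \<le> n"
  shows "measure_pmf.prob (gnp n p) {h. \<not> expanding n \<eta> \<phi> (set Q) (\<lambda>e. g e \<or> h e)}
     \<le> 2 * exp (- \<rho> / 4 * ln n) / (1 - exp (- \<rho> / 2))"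
proof -
  let ?q = "length Q"
  have q: "card (set Q) = ?q" using Q by (simp add: distinct_card)
  have qn: "?q \<le> n" using Q(2) q by (metis card_lessThan card_mono finite_lessThan)
  have p0: "0 \<le> p" using p by (meson divide_nonneg_nonneg less_imp_le of_nat_0_le_iff order_trans)
  define L where "L = (\<lambda>t::nat. 1 + ln (n / t))"
  \<comment> \<open>\<open>m t\<close> bounds the boundary of a set of size \<open>t\<close> that
    violates expansion; such a set then has at most \<open>2 * m t\<close> flips.\<close>
  define m where "m = (\<lambda>t. nat \<lfloor>\<phi> * t / L t\<rfloor>)"
  let ?I = "{t\<in>{1..?q}. ln n / 2 \<le> t \<and> t \<le> (1 - \<eta>) * ?q}"
  let ?T = "\<lambda>t. {T. T \<subseteq> set Q \<and> card (flips Q T) \<le> 2 * m t}"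
  let ?T' = "\<lambda>t. {T\<in>?T t. card T = t}"
  let ?B = "\<lambda>t. {B. B \<subseteq> set Q \<and> card B \<le> m t}"
  let ?ob = "\<lambda>h. outer_boundary (\<lambda>e. g e \<or> h e) (set Q)"
  have L1: "1 \<le> L t" if "1 \<le> t" "t \<le> ?q" for t
    using that qn by (auto simp: L_def)
  have finT: "finite (?T t)" for t by (rule finite_subset[of _ "Pow (set Q)"]) auto
  then have finT': "finite (?T' t)" for t by simp
  have finB: "finite (?B t)" for t by (rule finite_subset[of _ "Pow (set Q)"]) auto
  have "measure_pmf.prob (gnp n p) {h. \<not> expanding n \<eta> \<phi> (set Q) (\<lambda>e. g e \<or> h e)}
    \<le> measure_pmf.prob (gnp n p) {h. \<exists>t\<in>?I. \<exists>T\<in>?T' t. \<exists>B\<in>?B t. ?ob h T = B}"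
  proof (rule prob_pmf_mono_support)
    fix h assume "\<not> expanding n \<eta> \<phi> (set Q) (\<lambda>e. g e \<or> h e)"
    then obtain T where T: "T \<subseteq> set Q" "T \<noteq> {}" "card T \<le> (1 - \<eta>) * ?q"
      "card (?ob h T) * L (card T) < \<phi> * card T"
      by (auto simp: expanding_def not_le q L_def)
    let ?t = "card T"
    have t: "1 \<le> ?t" "?t \<le> ?q"
      using T(1,2) q by (metis One_nat_def Suc_leI card_gt_0_iff finite_set finite_subset, metis card_mono finite_set q T(1))
    have "T \<noteq> set Q"
    proof
      assume "T = set Q"
      then have "0 < \<eta> * ?q" using t \<eta> q by (intro mult_pos_pos) auto
      then show False using T(3) \<open>T = set Q\<close> q by (simp add: algebra_simps)
    qed
    then have fl: "flips Q T \<noteq> {}" using flips_nonempty T by blast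
    have suc: "successively (adj (\<lambda>e. g e \<or> h e)) Q"
      using Q(3) by (rule successively_mono) (auto simp: adj_def)
    have cf: "card (flips Q T) \<le> 2 * card (?ob h T)" by (rule card_flips_le[OF Q(1) suc])
    have "finite (flips Q T)" by (rule finite_subset[of _ "{..<?q}"]) (auto simp: flips_def)
    then have ob1: "1 \<le> card (?ob h T)" using fl cf card_gt_0_iff[of "flips Q T"] by linarith
    have obL: "card (?ob h T) < \<phi> * ?t / L ?t"
      using T(4) L1[OF t] by (subst pos_less_divide_eq) auto
    then have obm: "card (?ob h T) \<le> m ?t" by (simp add: m_def le_nat_iff le_floor_iff)
    \<comment> \<open>The boundary is nonempty, so a violation forces
      \<open>L t < \<phi> * t\<close> and hence \<open>t \<ge> ln n / 2\<close>. This excludes the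
      small sizes, for which the bound per size would not tend to 0.\<close>
    have "1 * L ?t \<le> card (?ob h T) * L ?t" using ob1 L1[OF t] by (intro mult_right_mono) auto
    then have "1 + ln n - ln ?t < \<phi> * ?t" using T(4) t n by (simp add: L_def ln_div)
    moreover have "\<phi> * ?t \<le> 1 * real ?t" using \<phi> by (intro mult_right_mono) auto
    moreover have "ln ?t \<le> ?t" using t ln_le_minus_one[of ?t] by simp
    ultimately have "ln n / 2 \<le> ?t" by linarith
    then have "?t \<in> ?I" "T \<in> ?T' ?t" "?ob h T \<in> ?B ?t"
      using t T cf obm by (auto simp: outer_boundary_def)
    then show "\<exists>t\<in>?I. \<exists>T\<in>?T' t. \<exists>B\<in>?B t. ?ob h T = B" by blast
  qed
  also have "\<dots> \<le> (\<Sum>t\<in>?I. \<Sum>T\<in>?T' t. \<Sum>B\<in>?B t. measure_pmf.prob (gnp n p) {h. ?ob h T = B})"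
    by (intro order_trans[OF prob_pmf_Bex_le] sum_mono finT' finB order_refl) auto
  also have "\<dots> \<le> (\<Sum>t\<in>?I. 2 * exp (- \<rho> * t))"
  proof (rule sum_mono)
    fix t assume tI: "t \<in> ?I"
    then have t: "1 \<le> t" "t \<le> ?q" "t \<le> (1 - \<eta>) * ?q" by auto
    let ?k = "\<epsilon> * \<gamma> * \<eta> / 2"
    have mt: "m t \<le> \<phi> * t / L t"
      using L1[OF t(1,2)] \<phi> unfolding m_def by (subst of_nat_nat) auto
    have "\<phi> * t / L t \<le> \<phi> * t / 1" using L1[OF t(1,2)] \<phi> by (intro divide_left_mono) auto
    also have "\<dots> \<le> \<phi> * ?q" using t \<phi> by auto
    also have "\<dots> \<le> \<eta> / 2 * ?q" using \<phi> by (intro mult_right_mono) auto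
    finally have mq: "m t \<le> \<eta> / 2 * ?q" using mt by linarith
    have each: "measure_pmf.prob (gnp n p) {h. ?ob h T = B} \<le> exp (- ?k * t)"
      if T: "T \<in> ?T' t" and B: "B \<in> ?B t" for T B
    proof -
      \<comment> \<open>\<open>T\<close> leaves out at least \<open>\<eta> * ?q\<close> path
        vertices, and \<open>B\<close> takes at most half of that number.\<close>
      have sz: "\<eta> / 2 * ?q \<le> real (?q - t - card B)"
      proof -
        have "card B \<le> m t" using B by simp
        then have "real (card B) \<le> \<eta> / 2 * ?q" using mq by linarith
        moreover have "t + \<eta> * ?q \<le> ?q" using t(3) by (simp add: algebra_simps)
        ultimately show ?thesis by (simp add: of_nat_diff)
      qed
      have "measure_pmf.prob (gnp n p) {h. ?ob h T = B} \<le> (1 - p) ^ (card T * (card (set Q) - card T - card B))"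
        by (rule prob_boundary_eq_le) (use p0 p Q T B in auto)
      also have "\<dots> = (1 - p) ^ (t * (?q - t - card B))" using T q by simp
      also have "\<dots> \<le> exp (- p) ^ (t * (?q - t - card B))"
        using p exp_ge_add_one_self[of "-p"] by (intro power_mono) auto
      also have "\<dots> = exp (- (p * (t * real (?q - t - card B))))" by (simp flip: exp_of_nat_mult add: mult_ac)
      also have "\<dots> \<le> exp (- ?k * t)"
      proof -
        have "\<epsilon> / n * (t * (\<eta> / 2 * (\<gamma> * n))) \<le> p * (t * real (?q - t - card B))"
        proof (intro mult_mono p(1))
          show "\<eta> / 2 * (\<gamma> * n) \<le> real (?q - t - card B)"
            using sz Q(4) \<eta> by (meson divide_nonneg_nonneg less_imp_le mult_left_mono order_trans zero_le_numeral)
          show "0 \<le> real t * (\<eta> / 2 * (\<gamma> * n))"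
          proof -
            have "0 < \<epsilon> * \<gamma> * \<eta> / 2"
            proof -
              have "0 \<le> ln (1 / \<delta>)" using \<delta> by simp
              then have "0 \<le> 3 * \<phi> * (1 + ln (1 / \<delta>))" using \<phi> by simp
              then show ?thesis using \<rho> \<delta> by linarith
            qed
            then have "0 < \<gamma>" using p(3) \<eta> by (simp add: zero_less_mult_iff)
            then show ?thesis using \<eta> by simp
          qed
          then show "0 \<le> \<eta> / 2 * (\<gamma> * n)" using t by (simp add: zero_le_mult_iff)
        qed (use p0 in auto)
        moreover have "\<epsilon> / n * (t * (\<eta> / 2 * (\<gamma> * n))) = ?k * t" using n by simp
        ultimately show ?thesis by simp
      qed
      finally show ?thesis .
    qed
    \<comment> \<open>With this weight the exponential factor of each count is only
      \<open>exp (\<delta> * t)\<close>, while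
      \<open>ln (1 / x) \<le> L t * (1 + ln (1 / \<delta>))\<close>, so that the denominator
      \<open>L t\<close> of \<open>m t\<close> cancels in \<open>xm\<close>.\<close>
    define x where "x = \<delta> * t / n"
    have x: "0 < x" "x \<le> 1"
      using \<delta> t qn n mult_mono[of \<delta> 1 "real t" "real n"] by (auto simp: x_def)
    have xq: "x * ?q \<le> \<delta> * t"
    proof -
      have "x * ?q \<le> x * n" using x qn by (intro mult_left_mono) auto
      then show ?thesis using n by (simp add: x_def)
    qed
    have cT: "card (?T' t) \<le> 2 * (exp (\<delta> * t) / x ^ (2 * m t))"
    proof -
      have "card (?T' t) \<le> card (?T t)" using finT by (intro card_mono) auto
      also have "\<dots> \<le> 2 * card {S. S \<subseteq> {..<?q} \<and> card S \<le> 2 * m t}" by (rule card_few_flips_le)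
      finally have "card (?T' t) \<le> 2 * real (card {S. S \<subseteq> {..<?q} \<and> card S \<le> 2 * m t})" by linarith
      moreover have "real (card {S. S \<subseteq> {..<?q} \<and> card S \<le> 2 * m t}) \<le> exp (x * ?q) / x ^ (2 * m t)"
        using card_small_subsets_le[of "{..<?q}" x "2 * m t"] x by (simp add: pos_le_divide_eq)
      moreover have "exp (x * ?q) / x ^ (2 * m t) \<le> exp (\<delta> * t) / x ^ (2 * m t)"
        using x xq by (intro divide_right_mono) auto
      ultimately show ?thesis by linarith
    qed
    have cB: "card (?B t) \<le> exp (\<delta> * t) / x ^ m t"
    proof -
      have "real (card (?B t)) \<le> exp (x * ?q) / x ^ m t"
        using card_small_subsets_le[of "set Q" x "m t"] x q by (simp add: pos_le_divide_eq)
      also have "\<dots> \<le> exp (\<delta> * t) / x ^ m t"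
        using x xq by (intro divide_right_mono) auto
      finally show ?thesis .
    qed
    have xm: "1 / x ^ (3 * m t) \<le> exp (3 * \<phi> * (1 + ln (1 / \<delta>)) * t)"
    proof -
      have "1 / x = exp (ln (1 / x))" using x by simp
      also have "ln (1 / x) = ln (n / t) + ln (1 / \<delta>)"
        using \<delta> t n by (simp add: x_def ln_div ln_mult)
      finally have "1 / x ^ (3 * m t) = exp (ln (n / t) + ln (1 / \<delta>)) ^ (3 * m t)"
        by (metis power_one_over)
      also have "\<dots> = exp (3 * (m t * (ln (n / t) + ln (1 / \<delta>))))"
        by (simp flip: exp_of_nat_mult)
      also have "m t * (ln (n / t) + ln (1 / \<delta>)) \<le> \<phi> * t / L t * (L t * (1 + ln (1 / \<delta>)))"
      proof (rule mult_mono[OF mt])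
        have l: "0 \<le> ln (1 / \<delta>)" using \<delta> by simp
        have "0 \<le> ln (n / t)" using L1[OF t(1,2)] by (simp add: L_def)
        then have "0 \<le> ln (n / t) * ln (1 / \<delta>)" using l by simp
        then show "ln (n / t) + ln (1 / \<delta>) \<le> L t * (1 + ln (1 / \<delta>))"
          by (simp add: L_def algebra_simps)
        show "0 \<le> ln (n / t) + ln (1 / \<delta>)" using l \<open>0 \<le> ln (n / t)\<close> by linarith
      qed (use L1[OF t(1,2)] \<phi> in auto)
      also have "\<phi> * t / L t * (L t * (1 + ln (1 / \<delta>))) = \<phi> * (1 + ln (1 / \<delta>)) * t"
        using L1[OF t(1,2)] by simp
      finally show ?thesis by (simp add: mult_ac)
    qed
    have "(\<Sum>T\<in>?T' t. \<Sum>B\<in>?B t. measure_pmf.prob (gnp n p) {h. ?ob h T = B})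
      \<le> (\<Sum>T\<in>?T' t. \<Sum>B\<in>?B t. exp (- ?k * t))"
      by (intro sum_mono each)
    also have "\<dots> = real (card (?T' t)) * real (card (?B t)) * exp (- ?k * t)" by simp
    also have "\<dots> \<le> (2 * (exp (\<delta> * t) / x ^ (2 * m t))) * (exp (\<delta> * t) / x ^ m t) * exp (- ?k * t)"
      by (intro mult_right_mono mult_mono cT cB) (use x in auto)
    also have "\<dots> = 2 * (exp (2 * \<delta> * t) * (1 / x ^ (3 * m t)) * exp (- ?k * t))"
    proof -
      have "x ^ (3 * m t) = x ^ (2 * m t) * x ^ m t" by (simp flip: power_add)
      moreover have "exp (2 * \<delta> * t) = exp (\<delta> * t) * exp (\<delta> * t)" by (simp flip: exp_add)
      ultimately show ?thesis by simp
    qed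
    also have "\<dots> \<le> 2 * (exp (2 * \<delta> * t) * exp (3 * \<phi> * (1 + ln (1 / \<delta>)) * t) * exp (- ?k * t))"
      by (intro mult_left_mono mult_right_mono xm) auto
    also have "\<dots> = 2 * exp ((2 * \<delta> + 3 * \<phi> * (1 + ln (1 / \<delta>)) - ?k) * t)"
      by (simp add: algebra_simps flip: exp_add)
    also have "\<dots> \<le> 2 * exp (- \<rho> * t)"
    proof -
      have "2 * \<delta> + 3 * \<phi> * (1 + ln (1 / \<delta>)) - ?k \<le> - \<rho>" using \<rho>(2) by linarith
      then have "(2 * \<delta> + 3 * \<phi> * (1 + ln (1 / \<delta>)) - ?k) * t \<le> - \<rho> * t"
        by (rule mult_right_mono) simp
      then show ?thesis by simp
    qed
    finally show "(\<Sum>T\<in>?T' t. \<Sum>B\<in>?B t. measure_pmf.prob (gnp n p) {h. ?ob h T = B}) \<le> 2 * exp (- \<rho> * t)" .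
  qed
  \<comment> \<open>Half of the rate, combined with \<open>t \<ge> ln n / 2\<close>, gives a
    negative power of \<open>n\<close>; the other half makes the sum geometric.\<close>
  also have "\<dots> \<le> (\<Sum>t\<in>?I. 2 * exp (- \<rho> / 4 * ln n) * exp (- \<rho> / 2) ^ t)"
  proof (rule sum_mono)
    fix t assume "t \<in> ?I"
    then have "\<rho> / 2 * (ln n / 2) \<le> \<rho> / 2 * t" using \<rho> by (intro mult_left_mono) auto
    then have "- \<rho> * t \<le> - \<rho> / 4 * ln n + t * (- \<rho> / 2)" by (simp add: field_simps)
    then show "2 * exp (- \<rho> * t) \<le> 2 * exp (- \<rho> / 4 * ln n) * exp (- \<rho> / 2) ^ t"
      by (simp flip: exp_of_nat_mult exp_add)
  qed
  also have "\<dots> = 2 * exp (- \<rho> / 4 * ln n) * (\<Sum>t\<in>?I. exp (- \<rho> / 2) ^ t)" by (simp add: sum_distrib_left)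
  also have "\<dots> \<le> 2 * exp (- \<rho> / 4 * ln n) * (1 / (1 - exp (- \<rho> / 2)))"
  proof (intro mult_left_mono)
    have "(\<Sum>t\<in>?I. exp (- \<rho> / 2) ^ t) \<le> (\<Sum>t. exp (- \<rho> / 2) ^ t)"
      using \<rho> by (intro sum_le_suminf summable_geometric) auto
    also have "\<dots> = 1 / (1 - exp (- \<rho> / 2))" using \<rho> by (intro suminf_geometric) auto
    finally show "(\<Sum>t\<in>?I. exp (- \<rho> / 2) ^ t) \<le> 1 / (1 - exp (- \<rho> / 2))" .
  qed auto
  finally show ?thesis by simp
qed

section \<open>Vertices far from the path\<close>

text \<open>Second moment method. Events with disjoint sets \<open>E v\<close> are independent, so
  only intersecting pairs contribute to the variance bound, each at most 1. Chebyshev's inequality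
  gives the first estimate, Markov's the second.\<close>

lemma prob_many_empty_le:
  fixes p a \<mu> :: real
  assumes "finite A" "finite V" "\<And>v. v \<in> V \<Longrightarrow> E v \<subseteq> A" "0 \<le> p" "p \<le> 1" "0 < a"
    and \<mu>: "\<mu> = (\<Sum>v\<in>V. (1 - p) ^ card (E v))"
  shows "measure_pmf.prob (rgraph A p) {f. \<mu> + a \<le> card {v\<in>V. \<forall>e\<in>E v. \<not> f e}}
     \<le> card {x\<in>V \<times> V. E (fst x) \<inter> E (snd x) \<noteq> {}} / a\<^sup>2"
    and "measure_pmf.prob (rgraph A p) {f. a \<le> card {v\<in>V. \<forall>e\<in>E v. \<not> f e}} \<le> \<mu> / a"
proof -
  let ?M = "measure_pmf (rgraph A p)"
  let ?X = "\<lambda>v f. indicator {f. \<forall>e\<in>E v. \<not> f e} f :: real"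
  let ?Z = "\<lambda>f. \<Sum>v\<in>V. ?X v f"
  let ?c = "\<lambda>x. if E (fst x) \<inter> E (snd x) \<noteq> {} then 1 else 0 :: real"
  note int = integrable_rgraph[OF assms(1)]
  note fin = finite_set_rgraph[OF assms(1)]
  have Z: "?Z f = card {v\<in>V. \<forall>e\<in>E v. \<not> f e}" for f
    using assms(2) by (simp add: indicator_def sum.If_cases Int_def)
  have EX: "(\<integral>f. ?X v f \<partial>?M) = (1 - p) ^ card (E v)" if "v \<in> V" for v
    using prob_rgraph_none[OF assms(1) assms(3)[OF that] assms(4,5)] by simp
  have EZ: "(\<integral>f. ?Z f \<partial>?M) = \<mu>"
    unfolding \<mu> by (subst Bochner_Integration.integral_sum[OF int]) (intro sum.cong refl EX)
  have EXX: "(\<integral>f. ?X (fst x) f * ?X (snd x) f \<partial>?M)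
      \<le> (1 - p) ^ card (E (fst x)) * (1 - p) ^ card (E (snd x)) + ?c x" if x: "x \<in> V \<times> V" for x
  proof -
    have sub: "E (fst x) \<union> E (snd x) \<subseteq> A"
      using x assms(3)[of "fst x"] assms(3)[of "snd x"] by auto
    then have finE: "finite (E (fst x))" "finite (E (snd x))" using assms(1) finite_subset by (metis finite_Un)+
    have "(\<lambda>f. ?X (fst x) f * ?X (snd x) f) = indicator {f. \<forall>e\<in>E (fst x) \<union> E (snd x). \<not> f e}"
      by (auto simp: indicator_def fun_eq_iff)
    then have "(\<integral>f. ?X (fst x) f * ?X (snd x) f \<partial>?M) = (1 - p) ^ card (E (fst x) \<union> E (snd x))"
      using prob_rgraph_none[OF assms(1) sub assms(4,5)] by simp
    also have "\<dots> \<le> (1 - p) ^ card (E (fst x)) * (1 - p) ^ card (E (snd x)) + ?c x"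
    proof (cases "E (fst x) \<inter> E (snd x) = {}")
      case True
      then show ?thesis using finE by (simp add: card_Un_disjoint power_add)
    next
      case False
      have "(1 - p) ^ card (E (fst x) \<union> E (snd x)) \<le> 1" using assms by (intro power_le_one) auto
      moreover have "0 \<le> (1 - p) ^ card (E (fst x)) * (1 - p) ^ card (E (snd x))" using assms by simp
      ultimately show ?thesis using False by simp
    qed
    finally show ?thesis .
  qed
  have "(\<integral>f. (?Z f)\<^sup>2 \<partial>?M) = (\<integral>f. (\<Sum>x\<in>V \<times> V. ?X (fst x) f * ?X (snd x) f) \<partial>?M)"
    by (simp add: power2_eq_square sum_product sum.cartesian_product case_prod_unfold)
  also have "\<dots> = (\<Sum>x\<in>V \<times> V. (\<integral>f. ?X (fst x) f * ?X (snd x) f \<partial>?M))"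
    by (rule Bochner_Integration.integral_sum[OF int])
  also have "\<dots> \<le> (\<Sum>x\<in>V \<times> V. (1 - p) ^ card (E (fst x)) * (1 - p) ^ card (E (snd x)) + ?c x)"
    by (intro sum_mono EXX)
  also have "\<dots> = \<mu>\<^sup>2 + (\<Sum>x\<in>V \<times> V. ?c x)"
    by (simp add: sum.distrib \<mu> power2_eq_square sum_product sum.cartesian_product case_prod_unfold)
  also have "(\<Sum>x\<in>V \<times> V. ?c x) = card {x\<in>V \<times> V. E (fst x) \<inter> E (snd x) \<noteq> {}}"
    using assms(2) by (simp add: sum.If_cases Int_def)
  finally have EZZ: "(\<integral>f. (?Z f)\<^sup>2 \<partial>?M) \<le> \<mu>\<^sup>2 + card {x\<in>V \<times> V. E (fst x) \<inter> E (snd x) \<noteq> {}}" .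
  have "(\<integral>f. (?Z f - \<mu>)\<^sup>2 \<partial>?M) = (\<integral>f. (?Z f)\<^sup>2 - 2 * \<mu> * ?Z f + \<mu>\<^sup>2 \<partial>?M)"
    by (simp add: power2_diff algebra_simps)
  also have "\<dots> = (\<integral>f. (?Z f)\<^sup>2 \<partial>?M) - 2 * \<mu> * (\<integral>f. ?Z f \<partial>?M) + \<mu>\<^sup>2"
    by (simp add: int del: integral_sum')
  also have "\<dots> \<le> card {x\<in>V \<times> V. E (fst x) \<inter> E (snd x) \<noteq> {}}"
    unfolding EZ using EZZ by (simp add: power2_eq_square)
  finally have var: "(\<integral>f. (?Z f - \<mu>)\<^sup>2 \<partial>?M) \<le> card {x\<in>V \<times> V. E (fst x) \<inter> E (snd x) \<noteq> {}}" .
  have "measure_pmf.prob (rgraph A p) {f. \<mu> + a \<le> card {v\<in>V. \<forall>e\<in>E v. \<not> f e}}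
      \<le> measure_pmf.prob (rgraph A p) {f. a\<^sup>2 \<le> (?Z f - \<mu>)\<^sup>2}"
  proof (rule prob_pmf_mono_support)
    fix f assume "\<mu> + a \<le> card {v\<in>V. \<forall>e\<in>E v. \<not> f e}"
    then show "a\<^sup>2 \<le> (?Z f - \<mu>)\<^sup>2" unfolding Z using assms by (intro power_mono) auto
  qed
  also have "\<dots> \<le> (\<integral>f. (?Z f - \<mu>)\<^sup>2 \<partial>?M) / a\<^sup>2"
    by (rule prob_pmf_markov[OF fin]) (use assms in auto)
  also have "\<dots> \<le> card {x\<in>V \<times> V. E (fst x) \<inter> E (snd x) \<noteq> {}} / a\<^sup>2"
    using var by (rule divide_right_mono) simp
  finally show "measure_pmf.prob (rgraph A p) {f. \<mu> + a \<le> card {v\<in>V. \<forall>e\<in>E v. \<not> f e}}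
     \<le> card {x\<in>V \<times> V. E (fst x) \<inter> E (snd x) \<noteq> {}} / a\<^sup>2" .
  have "measure_pmf.prob (rgraph A p) {f. a \<le> ?Z f} \<le> (\<integral>f. ?Z f \<partial>?M) / a"
    by (rule prob_pmf_markov[OF fin]) (use assms in \<open>auto intro: sum_nonneg\<close>)
  then show "measure_pmf.prob (rgraph A p) {f. a \<le> card {v\<in>V. \<forall>e\<in>E v. \<not> f e}} \<le> \<mu> / a"
    by (simp only: EZ) (simp only: Z)
qed

text \<open>Balls in this relation avoid \<open>Q\<close>, so they are determined without the pairs
  that join \<open>Q\<close> to its complement.\<close>

definition out_adj :: "(nat \<times> nat \<Rightarrow> bool) \<Rightarrow> nat set \<Rightarrow> nat \<Rightarrow> nat \<Rightarrow> bool" where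
  "out_adj G Q u v \<longleftrightarrow> adj G u v \<and> u \<notin> Q \<and> v \<notin> Q"

text \<open>Balls with at most \<open>k\<close> vertices are left out: without a neighbour in
  \<open>Q\<close> they are whole components.\<close>

definition far :: "nat \<Rightarrow> (nat \<times> nat \<Rightarrow> bool) \<Rightarrow> nat set \<Rightarrow> nat \<Rightarrow> nat set" where
  "far n G Q k = {v \<in> {..<n} - Q. card (nball (out_adj G Q) k {v}) > k \<and>
     (\<forall>w\<in>nball (out_adj G Q) k {v}. \<forall>u\<in>Q. \<not> adj G w u)}"

definition few_far :: "nat \<Rightarrow> real \<Rightarrow> nat set \<Rightarrow> (nat \<times> nat \<Rightarrow> bool) \<Rightarrow> bool" where
  "few_far n \<beta> Q G \<longleftrightarrow> (\<forall>k. real (card (far n G Q k)) \<le> 2 * n * \<beta> ^ k)"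

lemma power_powr:
  fixes a s :: real
  assumes "0 < a"
  shows "(a ^ k) powr s = (a powr s) ^ k"
  using assms by (induction k) (simp_all add: powr_mult)

text \<open>All pairs except those between \<open>Q\<close> and its complement are revealed first,
  which fixes the balls outside \<open>Q\<close>. A vertex whose ball has more than \<open>k\<close>
  vertices is then far with probability at most \<open>\<beta> ^ (2 * k)\<close>. Two such events
  can be dependent only if the balls meet, and slow growth limits the number of these pairs.\<close>

lemma prob_many_far_le:
  fixes p \<beta> s x C :: real
  assumes p: "0 \<le> p" "p \<le> 1" and \<beta>: "0 < \<beta>" "(1 - p) ^ card Q \<le> \<beta>\<^sup>2" "\<beta> < 1"
    and s: "0 < s" "s \<le> 1" and x: "x < 1" "(C\<^sup>2 / \<beta>\<^sup>2) powr s * \<beta> powr (1 - s) \<le> x" and C: "1 \<le> C"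
    and Q: "Q \<subseteq> {..<n}" and g: "\<And>e. g e \<Longrightarrow> e \<in> gnp_pairs n" and n: "1 \<le> n"
  shows "measure_pmf.prob (gnp n p) {h. slow_growth n C (\<lambda>e. g e \<or> h e) \<and> \<not> few_far n \<beta> Q (\<lambda>e. g e \<or> h e)}
    \<le> 4 * n powr (- s / 2) / (1 - x)"
proof -
  define U where "U = {..<n} - Q"
  define A where "A = (\<lambda>(w, u). edge w u) ` (U \<times> Q)"
  define B where "B = gnp_pairs n - A"
  have finQ: "finite Q" using Q finite_subset by blast
  have AB: "gnp_pairs n = A \<union> B" "A \<inter> B = {}"
    using Q by (auto simp: A_def B_def U_def edge_in_gnp_pairs)
  have finAB: "finite A" "finite B"
    using finQ finite_gnp_pairs by (auto simp: A_def B_def U_def)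
  have x0: "0 < x"
  proof -
    have "0 < (C\<^sup>2 / \<beta>\<^sup>2) powr s * \<beta> powr (1 - s)" using C \<beta> by simp
    then show ?thesis using x(2) by linarith
  qed
  have "measure_pmf.prob (rgraph (A \<union> B) p) {h. slow_growth n C (\<lambda>e. g e \<or> h e) \<and> \<not> few_far n \<beta> Q (\<lambda>e. g e \<or> h e)}
    \<le> 4 * n powr (- s / 2) / (1 - x)"
  proof (rule prob_rgraph_Un_le[OF finAB AB(2)])
    fix r assume r: "r \<in> set_pmf (rgraph B p)"
    \<comment> \<open>\<open>G f\<close> is the whole graph when the crossing pairs are given by
      \<open>f\<close>; the relation \<open>R\<close>, and with it every ball \<open>W k v\<close>,
      does not depend on \<open>f\<close>.\<close>
    define G where "G = (\<lambda>f e. g e \<or> (if e \<in> A then f e else r e))"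
    define R where "R = out_adj (\<lambda>e. g e \<or> r e) Q"
    define W where "W = (\<lambda>k v. nball R k {v})"
    have R: "out_adj (G f) Q = R" for f
    proof (intro ext)
      fix u v
      have "edge u v \<notin> A" if "u \<notin> Q" "v \<notin> Q" using that by (auto simp: A_def edge_eq_iff)
      then show "out_adj (G f) Q u v = R u v" by (auto simp: out_adj_def R_def G_def adj_edge)
    qed
    have Rsym: "R u v \<Longrightarrow> R v u" for u v by (auto simp: R_def out_adj_def adj_sym)
    have RU: "v \<in> U" if "R u v" for u v
    proof -
      have "edge u v \<in> gnp_pairs n" using that g[of "edge u v"] set_rgraphD[OF finAB(2) r, of "edge u v"] AB
        by (auto simp: R_def out_adj_def adj_edge)
      then show ?thesis using that by (auto simp: edge_in_gnp_pairs U_def R_def out_adj_def)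
    qed
    have WU: "W k v \<subseteq> U" if "v \<in> U" for k v
      unfolding W_def by (rule nball_subset_closed) (use that RU in auto)
    have finU: "finite U" "card U \<le> n" 
      using card_mono[of "{..<n}" U] by (auto simp: U_def)
    have finW: "finite (W k v)" if "v \<in> U" for k v using WU[OF that] finU finite_subset by blast
    define E where "E = (\<lambda>k v. (\<lambda>(w, u). edge w u) ` (W k v \<times> Q))"
    have EA: "E k v \<subseteq> A" if "v \<in> U" for k v using WU[OF that, of k] unfolding E_def A_def by (intro image_mono Sigma_mono) auto
    have cardE: "card (E k v) = card (W k v) * card Q" if "v \<in> U" for k v
    proof -
      have "inj_on (\<lambda>(w, u). edge w u) (W k v \<times> Q)"
        using WU[OF that, of k] by (auto simp: inj_on_def edge_eq_iff U_def)
      then show ?thesis by (simp add: E_def card_image card_cartesian_product)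
    qed
    define V where "V = (\<lambda>k. {v\<in>U. card (W k v) > k})"
    define Z where "Z = (\<lambda>k f. card {v\<in>V k. \<forall>e\<in>E k v. \<not> f e})"
    have finV: "finite (V k)" for k using finU by (simp add: V_def)
    have farZ: "card (far n (G f) Q k) \<le> Z k f" for f k
      unfolding Z_def
    proof (rule card_mono)
      show "far n (G f) Q k \<subseteq> {v\<in>V k. \<forall>e\<in>E k v. \<not> f e}"
      proof
        fix v assume v: "v \<in> far n (G f) Q k"
        then have vU: "v \<in> U" "card (W k v) > k" by (auto simp: far_def U_def W_def R)
        moreover have "\<not> f (edge w u)" if "w \<in> W k v" "u \<in> Q" for w u
        proof -
          have "\<not> adj (G f) w u" using v that by (auto simp: far_def W_def R)
          moreover have "w \<in> U" using WU[OF vU(1)] that by blast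
          moreover from this have "edge w u \<in> A" "w \<noteq> u" using that by (force simp: A_def, auto simp: U_def)
          ultimately show ?thesis by (auto simp: adj_edge G_def)
        qed
        ultimately show "v \<in> {v\<in>V k. \<forall>e\<in>E k v. \<not> f e}" by (auto simp: V_def E_def)
      qed
    qed (simp add: finV)
    \<comment> \<open>No ball has more than \<open>n\<close> vertices, so only finitely many radii
      enter the union bound.\<close>
    have Z0: "Z k f = 0" if "n \<le> k" for k f
    proof -
      have "card (W k v) \<le> n" if "v \<in> U" for v using WU[OF that] finU by (meson card_mono le_trans)
      then have "V k = {}" using \<open>n \<le> k\<close> by (fastforce simp: V_def)
      then show ?thesis by (simp add: Z_def)
    qed
    show "measure_pmf.prob (rgraph A p) {f. slow_growth n C (\<lambda>e. g e \<or> (if e \<in> A then f e else r e)) \<and>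
        \<not> few_far n \<beta> Q (\<lambda>e. g e \<or> (if e \<in> A then f e else r e))} \<le> 4 * n powr (- s / 2) / (1 - x)"
    proof (cases "\<forall>k. \<forall>v\<in>U. card (W (2 * k) v) \<le> 4 * C ^ (2 * k) * sqrt n")
      \<comment> \<open>An oversized ball outside \<open>Q\<close> contradicts slow growth for every
        \<open>f\<close>, so the event is empty.\<close>
      case False
      then obtain k v where kv: "v \<in> U" "card (W (2 * k) v) > 4 * C ^ (2 * k) * sqrt n" by (auto simp: not_le)
      have "\<not> slow_growth n C (G f)" for f
      proof
        assume *: "slow_growth n C (G f)"
        have "W (2 * k) v \<subseteq> nball (adj (G f)) (2 * k) {v}"
          unfolding W_def R[of f, symmetric] by (rule nball_mono) (auto simp: out_adj_def)
        moreover have "finite (nball (adj (G f)) (2 * k) {v})"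
        proof -
          have "nball (adj (G f)) (2 * k) {v} \<subseteq> {..<n}"
          proof (rule nball_subset_closed)
            fix u w assume "adj (G f) u w"
            then have "edge u w \<in> gnp_pairs n"
              using g[of "edge u w"] set_rgraphD[OF finAB(2) r, of "edge u w"] AB
              by (auto simp: adj_edge G_def split: if_splits)
            then show "w \<in> {..<n}" by (simp add: edge_in_gnp_pairs)
          qed (use kv in \<open>auto simp: U_def\<close>)
          then show ?thesis by (rule finite_subset) simp
        qed
        ultimately have "card (W (2 * k) v) \<le> card (nball (adj (G f)) (2 * k) {v})" by (intro card_mono)
        moreover have "card (nball (adj (G f)) (2 * k) {v}) \<le> 4 * C ^ (2 * k) * sqrt (card {v} * n)"
          using * kv(1) by (auto simp: slow_growth_def U_def)
        ultimately show False using kv(2) by simp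
      qed
      then show ?thesis using x by (simp add: G_def)
    next
      case True
      have pk: "measure_pmf.prob (rgraph A p) {f. 2 * n * \<beta> ^ k \<le> Z k f} \<le> 4 * n powr (- s / 2) * x ^ k" for k
      proof -
        let ?\<mu> = "\<Sum>v\<in>V k. (1 - p) ^ card (E k v)"
        let ?P = "measure_pmf.prob (rgraph A p) {f. 2 * n * \<beta> ^ k \<le> Z k f}"
        let ?D = "C\<^sup>2 / \<beta>\<^sup>2"
        have VU: "V k \<subseteq> U" by (auto simp: V_def)
        have cV: "card (V k) \<le> n" using VU finU by (meson card_mono le_trans)
        have a0: "0 < n * \<beta> ^ k" using n \<beta> by simp
        \<comment> \<open>Each of the more than \<open>k\<close> ball vertices misses
          \<open>Q\<close> with probability at most \<open>\<beta>\<^sup>2\<close>. The expectation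
          is thus at most \<open>\<beta> ^ k\<close> times the threshold
          \<open>n * \<beta> ^ k\<close>, and Markov's inequality turns this ratio into
          \<open>P1\<close>.\<close>
        have "?\<mu> \<le> (\<Sum>v\<in>V k. (\<beta>\<^sup>2) ^ k)"
        proof (rule sum_mono)
          fix v assume v: "v \<in> V k"
          then have vU: "v \<in> U" "k \<le> card (W k v)" by (auto simp: V_def)
          have "(1 - p) ^ card (E k v) = ((1 - p) ^ card Q) ^ card (W k v)"
            using cardE[OF vU(1)] by (simp add: mult.commute flip: power_mult)
          also have "\<dots> \<le> ((1 - p) ^ card Q) ^ k" using vU p by (intro power_decreasing power_le_one) auto
          also have "\<dots> \<le> (\<beta>\<^sup>2) ^ k" using p \<beta> by (intro power_mono) auto
          finally show "(1 - p) ^ card (E k v) \<le> (\<beta>\<^sup>2) ^ k" .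
        qed
        also have "\<dots> = card (V k) * (\<beta>\<^sup>2) ^ k" by simp
        also have "\<dots> \<le> n * (\<beta>\<^sup>2) ^ k" using cV by (intro mult_right_mono) auto
        also have "\<dots> = n * \<beta> ^ k * \<beta> ^ k" by (simp add: power2_eq_square power_mult_distrib)
        finally have \<mu>: "?\<mu> \<le> n * \<beta> ^ k * \<beta> ^ k" .
        also have "\<dots> \<le> n * \<beta> ^ k * 1" using \<beta> by (intro mult_left_mono power_le_one) auto
        finally have \<mu>1: "?\<mu> \<le> n * \<beta> ^ k" by simp
        have V': "\<And>v. v \<in> V k \<Longrightarrow> v \<in> U" using VU by auto
        note many = prob_many_empty_le[OF finAB(1) finV EA[OF V'] p a0 refl]
        have "?P \<le> measure_pmf.prob (rgraph A p) {f. n * \<beta> ^ k \<le> Z k f}"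
          using a0 by (intro prob_pmf_mono_support) auto
        also have "\<dots> \<le> ?\<mu> / (n * \<beta> ^ k)" using many(2) by (simp add: Z_def)
        also have "\<dots> \<le> \<beta> ^ k" using \<mu> a0 by (simp add: pos_divide_le_eq mult.commute)
        finally have P1: "?P \<le> \<beta> ^ k" .
        have "?P \<le> measure_pmf.prob (rgraph A p) {f. ?\<mu> + n * \<beta> ^ k \<le> Z k f}"
          using \<mu>1 by (intro prob_pmf_mono_support) auto
        also have "\<dots> \<le> card {y\<in>V k \<times> V k. E k (fst y) \<inter> E k (snd y) \<noteq> {}} / (n * \<beta> ^ k)\<^sup>2"
          using many(1) by (simp add: Z_def)
        also have "\<dots> \<le> (n * (4 * C ^ (2 * k) * sqrt n)) / (n * \<beta> ^ k)\<^sup>2"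
        proof (rule divide_right_mono)
          \<comment> \<open>All these pairs lead from outside \<open>Q\<close> into
            \<open>Q\<close>, so a common pair of \<open>E k u\<close> and \<open>E k v\<close>
            yields a common vertex of the two balls; hence \<open>v\<close> is within distance
            \<open>2 * k\<close> of \<open>u\<close>.\<close>
          have "{y\<in>V k \<times> V k. E k (fst y) \<inter> E k (snd y) \<noteq> {}} \<subseteq> (SIGMA u:V k. W (2 * k) u)"
          proof safe
            fix u v e assume uv: "u \<in> V k" "v \<in> V k" "e \<in> E k (fst (u, v))" "e \<in> E k (snd (u, v))"
            then obtain w a w' a' where w: "w \<in> W k u" "a \<in> Q" "e = edge w a" "w' \<in> W k v" "a' \<in> Q" "e = edge w' a'"
              by (auto simp: E_def)
            moreover have "w \<in> U" "w' \<in> U" using WU V' uv w by blast+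
            ultimately have "w = w'" by (auto simp: edge_eq_iff U_def)
            then have "v \<in> nball R k {w}" using w(4) nball_sym_mem[of R w k v] Rsym by (auto simp: W_def)
            also have "\<dots> \<subseteq> nball R k (nball R k {u})" by (rule nball_mono) (use w in \<open>auto simp: W_def\<close>)
            also have "\<dots> = W (2 * k) u" by (simp add: W_def mult_2 nball_add)
            finally show "v \<in> W (2 * k) u" .
          qed
          then have "card {y\<in>V k \<times> V k. E k (fst y) \<inter> E k (snd y) \<noteq> {}} \<le> card (SIGMA u:V k. W (2 * k) u)"
            using finV finW V' by (intro card_mono finite_SigmaI) auto
          also have "\<dots> = (\<Sum>u\<in>V k. card (W (2 * k) u))" using finV finW V' by (intro card_SigmaI) auto
          finally have "real (card {y\<in>V k \<times> V k. E k (fst y) \<inter> E k (snd y) \<noteq> {}}) \<le> real (\<Sum>u\<in>V k. card (W (2 * k) u))"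
            by (rule of_nat_mono)
          also have "\<dots> = (\<Sum>u\<in>V k. real (card (W (2 * k) u)))" by simp
          also have "\<dots> \<le> (\<Sum>u\<in>V k. 4 * C ^ (2 * k) * sqrt n)" using True V' by (intro sum_mono) auto
          also have "\<dots> = card (V k) * (4 * C ^ (2 * k) * sqrt n)" by simp
          also have "\<dots> \<le> n * (4 * C ^ (2 * k) * sqrt n)" using cV C by (intro mult_right_mono) auto
          finally show "real (card {y\<in>V k \<times> V k. E k (fst y) \<inter> E k (snd y) \<noteq> {}}) \<le> n * (4 * C ^ (2 * k) * sqrt n)" .
        qed simp
        also have "\<dots> = 4 * ?D ^ k * n powr (- 1 / 2)"
        proof -
          have "n powr (- 1 / 2) = sqrt n / n"
            using n by (simp add: powr_minus_divide powr_half_sqrt field_simps)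
          then show ?thesis using n \<beta> by (simp add: power2_eq_square power_mult power_mult_distrib power_divide mult_ac)
        qed
        finally have P2: "?P \<le> 4 * ?D ^ k * n powr (- 1 / 2)" .
        txt \<open>The Chebyshev bound \<open>P2\<close> is good for small \<open>k\<close>, the Markov bound \<open>P1\<close> for large \<open>k\<close>; a weighted
          geometric mean of the two is summable over all \<open>k\<close> with a sum tending to \<open>0\<close>.\<close>
        have D0: "0 < ?D" using C \<beta> by simp
        have "?P \<le> ?P powr s * ?P powr (1 - s)"
        proof (cases "?P = 0")
          case False
          then have "0 < ?P" using measure_nonneg[of "measure_pmf (rgraph A p)"] by (metis less_eq_real_def)
          then show ?thesis by (simp flip: powr_add)
        qed simp
        also have "\<dots> \<le> (4 * ?D ^ k * n powr (- 1 / 2)) powr s * (\<beta> ^ k) powr (1 - s)"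
          by (intro mult_mono powr_mono2 P1 P2) (use s in auto)
        also have "\<dots> = 4 powr s * n powr (- s / 2) * ((?D powr s) ^ k * (\<beta> powr (1 - s)) ^ k)"
        proof -
          have "(?D ^ k) powr s = (?D powr s) ^ k"
            using D0 by (rule power_powr)
          moreover have "(\<beta> ^ k) powr (1 - s) = (\<beta> powr (1 - s)) ^ k"
            using \<beta> by (intro power_powr)
          ultimately show ?thesis using D0 by (simp add: powr_mult powr_powr)
        qed
        also have "\<dots> \<le> 4 * n powr (- s / 2) * x ^ k"
        proof (intro mult_mono)
          show "4 powr s \<le> (4::real)" using powr_mono[of s 1 "4::real"] s by simp
          show "(?D powr s) ^ k * (\<beta> powr (1 - s)) ^ k \<le> x ^ k"
            unfolding power_mult_distrib[symmetric] using x D0 by (intro power_mono) auto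
        qed auto
        finally show ?thesis .
      qed
      have "measure_pmf.prob (rgraph A p) {f. slow_growth n C (G f) \<and> \<not> few_far n \<beta> Q (G f)}
        \<le> measure_pmf.prob (rgraph A p) {f. \<exists>k\<in>{..<n}. 2 * n * \<beta> ^ k \<le> Z k f}"
      proof (rule prob_pmf_mono_support)
        fix f assume "slow_growth n C (G f) \<and> \<not> few_far n \<beta> Q (G f)"
        then obtain k where k: "2 * n * \<beta> ^ k < card (far n (G f) Q k)" by (auto simp: few_far_def not_le)
        then have *: "2 * n * \<beta> ^ k < Z k f" using farZ[of f k] by linarith
        moreover have "k < n"
        proof (rule ccontr)
          assume "\<not> k < n"
          then have "2 * n * \<beta> ^ k < 0" using Z0[of k f] * by simp
          then show False using \<beta> by (simp add: mult_less_0_iff)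
        qed
        ultimately show "\<exists>k\<in>{..<n}. 2 * n * \<beta> ^ k \<le> Z k f" by force
      qed
      also have "\<dots> \<le> (\<Sum>k<n. measure_pmf.prob (rgraph A p) {f. 2 * n * \<beta> ^ k \<le> Z k f})"
        by (rule prob_pmf_Bex_le) simp
      also have "\<dots> \<le> (\<Sum>k<n. 4 * n powr (- s / 2) * x ^ k)" by (intro sum_mono pk)
      also have "\<dots> = 4 * n powr (- s / 2) * (\<Sum>k<n. x ^ k)" by (simp add: sum_distrib_left)
      also have "\<dots> \<le> 4 * n powr (- s / 2) * (1 / (1 - x))"
      proof (intro mult_left_mono)
        have "(\<Sum>k<n. x ^ k) \<le> (\<Sum>k. x ^ k)"
          using x x0 by (intro sum_le_suminf summable_geometric) auto
        also have "\<dots> = 1 / (1 - x)" using x x0 by (intro suminf_geometric) auto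
        finally show "(\<Sum>k<n. x ^ k) \<le> 1 / (1 - x)" .
      qed auto
      finally show ?thesis by (simp add: G_def)
    qed
  qed
  then show ?thesis by (simp add: gnp_eq_rgraph AB(1))
qed

section \<open>Concentration from expansion\<close>

lemma successively_adj_rtranclp:
  assumes "successively (adj G) (x # xs)" "y \<in> set (x # xs)"
  shows "(adj G)\<^sup>*\<^sup>* x y"
  using assms
proof (induction xs arbitrary: x)
  case (Cons z zs)
  then have "adj G x z" "successively (adj G) (z # zs)" by auto
  show ?case
  proof (cases "y = x")
    case False
    then have "(adj G)\<^sup>*\<^sup>* z y" using Cons by auto
    then show ?thesis using \<open>adj G x z\<close> by (meson converse_rtranclp_into_rtranclp)
  qed simp
qed simp

lemma rtranclp_adj_sym: "(adj G)\<^sup>*\<^sup>* x y \<Longrightarrow> (adj G)\<^sup>*\<^sup>* y x"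
proof (induction rule: rtranclp_induct)
  case (step y z)
  then have "adj G z y" using adj_sym[of G y z] by simp
  then show ?case using step.IH by (rule converse_rtranclp_into_rtranclp)
qed simp

lemma rtranclp_closed:
  assumes "R\<^sup>*\<^sup>* x y" "x \<in> W" "\<And>u w. u \<in> W \<Longrightarrow> R u w \<Longrightarrow> w \<in> W"
  shows "y \<in> W"
  using assms by (induction rule: rtranclp_induct) auto

section \<open>Deterministic argument on a graph with the typical properties\<close>

text \<open>At radius \<open>k1\<close> at most \<open>\<gamma> * n / 8\<close> vertices are far. By
  slow growth, \<open>\<eta> * n\<close> is then a lower bound for the number of path vertices close
  to the lower half of the component.\<close>

locale giant =
  fixes n :: nat and G :: "nat \<times> nat \<Rightarrow> bool" and Q :: "nat list" and C \<beta> \<gamma> \<eta> \<phi> :: real and k1 :: nat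
  assumes G: "\<And>e. G e \<Longrightarrow> e \<in> gnp_pairs n"
    and Q: "distinct Q" "set Q \<subseteq> {..<n}" "successively (adj G) Q" "\<gamma> * n \<le> length Q"
    and \<gamma>: "0 < \<gamma>" and n: "k1 < \<gamma> * n"
    and slow: "slow_growth n C G" and C: "1 \<le> C"
    and few: "few_far n \<beta> (set Q) G" and \<beta>: "0 < \<beta>" "\<beta> < 1"
    and k1: "16 * \<beta> ^ k1 \<le> \<gamma>"
    and \<eta>: "\<eta> = (\<gamma> / (16 * C ^ Suc k1))\<^sup>2"
    and expand: "expanding n \<eta> \<phi> (set Q) G" and \<phi>: "0 < \<phi>" "\<phi> \<le> 1"
begin

lemma adj_less: "adj G u v \<Longrightarrow> u < n \<and> v < n"
  using G[of "edge u v"] by (auto simp: adj_edge edge_in_gnp_pairs)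

lemma n_pos: "0 < n"
proof -
  have "0 \<le> real k1" by simp
  then have "0 < \<gamma> * n" using n by linarith
  then show ?thesis using \<gamma> by (simp add: zero_less_mult_iff)
qed

lemma Q_nonempty: "Q \<noteq> []"
  using Q(4) n by auto

lemma nball_less: "T \<subseteq> {..<n} \<Longrightarrow> nball (adj G) j T \<subseteq> {..<n}"
  by (rule nball_subset_closed) (auto dest: adj_less)

lemma card_nball: "T \<subseteq> {..<n} \<Longrightarrow> card (nball (adj G) j T) \<le> 4 * C ^ j * sqrt (card T * n)"
  using slow by (simp add: slow_growth_def)

text \<open>A ball with at most \<open>k\<close> vertices after \<open>k\<close> rounds has stopped
  growing; as it also has no neighbour on the path, it is closed under adjacency.\<close>

lemma isolated_nball:
  assumes "v < n" "v \<notin> set Q" "\<And>w u. w \<in> nball (out_adj G (set Q)) k {v} \<Longrightarrow> u \<in> set Q \<Longrightarrow> \<not> adj G w u"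
    and "\<not> card (nball (out_adj G (set Q)) k {v}) > k"
  shows "component n G v \<subseteq> nball (out_adj G (set Q)) k {v}" (is "_ \<subseteq> ?W")
proof -
  have W: "?W \<subseteq> {..<n} - set Q"
    by (rule nball_subset_closed) (use assms(1,2) in \<open>auto simp: out_adj_def dest: adj_less\<close>)
  have "w \<in> {..<n}" if "out_adj G (set Q) u w" for u w
    using that adj_less by (auto simp: out_adj_def)
  then have "\<forall>u\<in>?W. \<forall>w. out_adj G (set Q) u w \<longrightarrow> w \<in> ?W"
    using nball_grows_or_closed[of "{..<n}" v "out_adj G (set Q)" k] assms(1,4) by blast
  then have closed: "w \<in> ?W" if "u \<in> ?W" "adj G u w" for u w
    using that W assms(3)[of u w] by (auto simp: out_adj_def)
  show ?thesis
  proof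
    fix y assume "y \<in> component n G v"
    then have "(adj G)\<^sup>*\<^sup>* v y" by (simp add: component_def)
    then show "y \<in> ?W"
    proof (rule rtranclp_closed)
      show "v \<in> ?W" using nball_increasing[of 0 k "out_adj G (set Q)" "{v}"] by auto
    qed (use closed in auto)
  qed
qed

section \<open>The largest component and the path\<close>

context
  fixes H :: "nat set"
  assumes H: "largest_component n G H"
begin

lemma H_component:
  assumes "v \<in> H"
  shows "H = component n G v"
proof -
  obtain u where u: "H = component n G u"
    using H by (auto simp: largest_component_def components_def)
  then have "(adj G)\<^sup>*\<^sup>* u v" using assms by (simp add: component_def)
  then have "(adj G)\<^sup>*\<^sup>* u w \<longleftrightarrow> (adj G)\<^sup>*\<^sup>* v w" for w
    using rtranclp_trans rtranclp_adj_sym by metis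
  then show ?thesis by (simp add: u component_def)
qed

lemma H_less: "H \<subseteq> {..<n}"
  using H by (auto simp: largest_component_def components_def component_def)

lemma finite_H: "finite H"
  using H_less finite_subset by blast

lemma H_closed: "v \<in> H \<Longrightarrow> adj G v w \<Longrightarrow> w \<in> H"
  using H_component[of v] adj_less[of v w] by (auto simp: component_def)

lemma path_subset: "v \<in> set Q \<Longrightarrow> set Q \<subseteq> component n G v"
proof
  fix u assume "v \<in> set Q" "u \<in> set Q"
  obtain x xs where "Q = x # xs" using Q_nonempty by (cases Q) auto
  then have "(adj G)\<^sup>*\<^sup>* x v" "(adj G)\<^sup>*\<^sup>* x u"
    using successively_adj_rtranclp Q(3) \<open>v \<in> set Q\<close> \<open>u \<in> set Q\<close> by blast+
  then have "(adj G)\<^sup>*\<^sup>* v u" using rtranclp_adj_sym rtranclp_trans by metis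
  then show "u \<in> component n G v" using Q(2) \<open>u \<in> set Q\<close> by (auto simp: component_def)
qed

lemma card_H: "\<gamma> * n \<le> card H"
proof -
  obtain v where v: "v \<in> set Q" using Q_nonempty by (meson list.set_sel(1))
  then have "card (component n G v) \<le> card H"
    using H Q(2) by (auto simp: largest_component_def components_def)
  moreover have "card (set Q) \<le> card (component n G v)"
    by (rule card_mono[OF _ path_subset[OF v]]) (simp add: component_def)
  ultimately show ?thesis using Q by (simp add: distinct_card)
qed

text \<open>Otherwise all balls inside \<open>H\<close> avoid the path and, since
  \<open>card H > k1\<close>, have more than \<open>k1\<close> vertices at radius \<open>k1\<close>.
  Then all of \<open>H\<close> is far and \<open>card H \<le> \<gamma> * n / 8\<close>, although a
  largest component has at least as many vertices as the path.\<close>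

lemma path_in_H: "set Q \<subseteq> H"
proof (cases "H \<inter> set Q = {}")
  case False
  then obtain v where "v \<in> H" "v \<in> set Q" by blast
  then show ?thesis using path_subset H_component by blast
next
  case True
  have "H \<subseteq> far n G (set Q) k1"
  proof
    fix v assume v: "v \<in> H"
    let ?W = "nball (out_adj G (set Q)) k1 {v}"
    have WH: "?W \<subseteq> H" by (rule nball_subset_closed) (use v H_closed in \<open>auto simp: out_adj_def\<close>)
    have noadj: "\<not> adj G w u" if "w \<in> ?W" "u \<in> set Q" for w u
      using WH H_closed True that by blast
    have vn: "v < n" "v \<notin> set Q" using v H_less True by auto
    have "card ?W > k1"
    proof (rule ccontr)
      assume *: "\<not> card ?W > k1"
      have "component n G v \<subseteq> ?W" by (rule isolated_nball[OF vn noadj *])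
      then have "card H \<le> card ?W" using H_component[OF v] WH finite_H by (metis card_mono finite_subset)
      then show False using * card_H n by linarith
    qed
    then show "v \<in> far n G (set Q) k1" using vn noadj by (auto simp: far_def)
  qed
  then have "card H \<le> card (far n G (set Q) k1)" by (intro card_mono) (auto simp: far_def)
  also have "\<dots> \<le> 2 * n * \<beta> ^ k1" using few by (simp add: few_far_def)
  finally have "\<gamma> * n \<le> 2 * \<beta> ^ k1 * n" using card_H by (simp add: mult_ac)
  then have "\<gamma> \<le> 2 * \<beta> ^ k1" using n_pos by simp
  then have "\<gamma> \<le> \<gamma> / 8" using k1 by linarith
  then show ?thesis using \<gamma> by simp
qed

text \<open>If the ball outside the path has a neighbour on the path, that neighbour serves as
  \<open>u\<close>. Otherwise, as \<open>v\<close> is not far, the ball is small and contains the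
  whole component, which contradicts that the path lies in \<open>H\<close>.\<close>

lemma far_or_near:
  assumes v: "v \<in> H" "v \<notin> far n G (set Q) j"
  shows "\<exists>u\<in>set Q. v \<in> nball (adj G) (Suc j) {u}"
proof (cases "v \<in> set Q")
  case True
  then show ?thesis using nball_increasing[of 0 "Suc j" "adj G" "{v}"] by auto
next
  case False
  let ?W = "nball (out_adj G (set Q)) j {v}"
  have vn: "v < n" using v H_less by auto
  show ?thesis
  proof (cases "\<exists>w\<in>?W. \<exists>u\<in>set Q. adj G w u")
    case True
    then obtain w u where wu: "w \<in> ?W" "u \<in> set Q" "adj G w u" by blast
    have "v \<in> nball (out_adj G (set Q)) j {w}"
      by (rule nball_sym_mem[OF _ wu(1)]) (auto simp: out_adj_def adj_sym)
    also have "\<dots> \<subseteq> nball (adj G) j (nball (adj G) 1 {u})"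
      by (rule nball_mono) (use wu(3) adj_sym[of G w u] in \<open>auto simp: out_adj_def\<close>)
    also have "\<dots> = nball (adj G) (Suc j) {u}" by (rule nball_Suc_inner[symmetric])
    finally show ?thesis using wu by blast
  next
    case noadj: False
    then have "\<not> card ?W > j" using v vn False by (auto simp: far_def)
    then have "component n G v \<subseteq> ?W" using isolated_nball[OF vn False] noadj by blast
    then have "set Q \<subseteq> ?W" using path_in_H H_component[OF v(1)] by auto
    moreover have "?W \<subseteq> - set Q" by (rule nball_subset_closed) (use False in \<open>auto simp: out_adj_def\<close>)
    ultimately show ?thesis using Q_nonempty by (metis (no_types, opaque_lifting) ComplD hd_in_set subset_eq)
  qed
qed

text \<open>Transfer between component and path: outside the far set, \<open>S\<close> lies in a
  ball around its contact set \<open>T\<close>. It serves in both directions, to bound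
  \<open>T\<close> from below for large \<open>S\<close> and to bound \<open>S\<close> from above
  for small \<open>T\<close>.\<close>

lemma card_subset_far_near:
  assumes "S \<subseteq> H" "T \<subseteq> set Q"
    and "\<And>v u. v \<in> S \<Longrightarrow> u \<in> set Q \<Longrightarrow> v \<in> nball (adj G) (Suc j) {u} \<Longrightarrow> u \<in> T"
  shows "card S \<le> 2 * n * \<beta> ^ j + 4 * C ^ Suc j * sqrt (card T * n)"
proof -
  have T: "T \<subseteq> {..<n}" using assms Q(2) by auto
  have "S \<subseteq> far n G (set Q) j \<union> nball (adj G) (Suc j) T"
  proof
    fix v assume v: "v \<in> S"
    show "v \<in> far n G (set Q) j \<union> nball (adj G) (Suc j) T"
    proof (cases "v \<in> far n G (set Q) j")
      case False
      then obtain u where u: "u \<in> set Q" "v \<in> nball (adj G) (Suc j) {u}" using far_or_near v assms(1) by blast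
      then have "u \<in> T" using assms(3) v by blast
      then have "nball (adj G) (Suc j) {u} \<subseteq> nball (adj G) (Suc j) T" by (intro nball_mono) auto
      then show ?thesis using u by blast
    qed simp
  qed
  then have "card S \<le> card (far n G (set Q) j \<union> nball (adj G) (Suc j) T)"
    by (intro card_mono finite_UnI finite_subset[OF nball_less[OF T]]) (auto simp: far_def)
  also have "\<dots> \<le> card (far n G (set Q) j) + card (nball (adj G) (Suc j) T)" by (rule card_Un_le)
  finally have "real (card S) \<le> real (card (far n G (set Q) j)) + real (card (nball (adj G) (Suc j) T))"
    by (metis of_nat_add of_nat_le_iff)
  also have "\<dots> \<le> 2 * n * \<beta> ^ j + 4 * C ^ Suc j * sqrt (card T * n)"
  proof (rule add_mono)
    show "card (far n G (set Q) j) \<le> 2 * n * \<beta> ^ j" using few by (simp add: few_far_def)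
  qed (rule card_nball[OF T])
  finally show ?thesis .
qed

section \<open>Levels of a Lipschitz function\<close>

text \<open>This is one half of the median condition; the other half is the same condition for
  \<open>- f\<close> and \<open>- m\<close>, so one argument yields both tails.\<close>

context
  fixes f :: "nat \<Rightarrow> real" and m :: real
  assumes f: "lipschitz_on_graph G H f" and m: "card H \<le> 2 * card {v\<in>H. f v \<le> m}"
begin

lemma lipschitz_near:
  assumes "u \<in> set Q" "v \<in> nball (adj G) j {u}"
  shows "\<bar>f v - f u\<bar> \<le> j"
proof -
  have "u \<in> H" using assms path_in_H by auto
  from lipschitz_nball[OF assms(2) this, of f] show ?thesis
    using f H_closed by (auto simp: lipschitz_on_graph_def)
qed

text \<open>The shift \<open>Suc k1\<close> is the distance within which the non-far vertices of the
  lower half reach the path.\<close>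

definition upper :: "nat \<Rightarrow> nat set" where
  "upper k = {u\<in>set Q. f u > m + Suc k1 + k}"

text \<open>At least \<open>\<gamma> * n / 2\<close> vertices have value at most \<open>m\<close>,
  and at most \<open>\<gamma> * n / 8\<close> of them are far. The rest lies within
  \<open>Suc k1\<close> of path vertices with value at most \<open>m + Suc k1\<close>, so by slow
  growth there are at least \<open>\<eta> * n\<close> of those.\<close>

lemma upper_small: "card (upper k) \<le> (1 - \<eta>) * card (set Q)"
proof -
  let ?T = "{u\<in>set Q. f u \<le> m + Suc k1}"
  have "card {v\<in>H. f v \<le> m} \<le> 2 * n * \<beta> ^ k1 + 4 * C ^ Suc k1 * sqrt (card ?T * n)"
  proof (rule card_subset_far_near)
    fix v u assume "v \<in> {v\<in>H. f v \<le> m}" "u \<in> set Q" "v \<in> nball (adj G) (Suc k1) {u}"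
    moreover from this have "\<bar>f v - f u\<bar> \<le> Suc k1" by (intro lipschitz_near)
    ultimately show "u \<in> ?T" by auto
  qed auto
  moreover have "\<gamma> * n \<le> 2 * real (card {v\<in>H. f v \<le> m})" using card_H m by linarith
  moreover have "16 * \<beta> ^ k1 * n \<le> \<gamma> * n" using k1 by (intro mult_right_mono) auto
  moreover have "0 \<le> \<gamma> * n" using \<gamma> by simp
  ultimately have "\<gamma> * n \<le> 16 * C ^ Suc k1 * sqrt (card ?T * n)" by (simp add: mult_ac)
  then have "\<gamma> / (16 * C ^ Suc k1) * n \<le> sqrt (card ?T * n)"
    using C by (simp add: pos_divide_le_eq mult_ac)
  then have "(\<gamma> / (16 * C ^ Suc k1) * n)\<^sup>2 \<le> (sqrt (card ?T * n))\<^sup>2"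
    using \<gamma> C by (intro power_mono) auto
  then have "\<eta> * n * n \<le> card ?T * real n"
    by (simp only: \<eta> power_mult_distrib real_sqrt_pow2_iff[THEN iffD2] of_nat_0_le_iff) (simp add: power2_eq_square mult_ac)
  then have T: "\<eta> * n \<le> card ?T" using n_pos by simp
  have "card (set Q) \<le> n" using Q(2) by (metis card_lessThan card_mono finite_lessThan)
  then have "\<eta> * card (set Q) \<le> \<eta> * n" by (intro mult_left_mono) (auto simp: \<eta>)
  moreover have "card (upper k) + card ?T \<le> card (set Q)"
  proof -
    have "card (upper k) + card ?T = card (upper k \<union> ?T)"
      by (rule card_Un_disjoint[symmetric]) (auto simp: upper_def)
    also have "\<dots> \<le> card (set Q)" by (rule card_mono) (auto simp: upper_def)
    finally show ?thesis .
  qed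
  ultimately show ?thesis using T by (simp add: algebra_simps)
qed

text \<open>An edge changes \<open>f\<close> by at most 1, so the boundary of a level lies in the
  next lower level.\<close>

lemma upper_step: "card (upper (Suc k)) + card (outer_boundary G (set Q) (upper (Suc k))) \<le> card (upper k)"
proof -
  let ?B = "outer_boundary G (set Q) (upper (Suc k))"
  have "?B \<subseteq> upper k"
  proof
    fix u assume "u \<in> ?B"
    then obtain v where v: "u \<in> set Q" "v \<in> upper (Suc k)" "adj G v u" by (auto simp: outer_boundary_def)
    then have "\<bar>f v - f u\<bar> \<le> 1" using f path_in_H by (auto simp: lipschitz_on_graph_def upper_def)
    then show "u \<in> upper k" using v by (auto simp: upper_def)
  qed
  moreover have "upper (Suc k) \<subseteq> upper k" by (auto simp: upper_def)
  moreover have "finite (upper k)" by (simp add: upper_def)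
  moreover have "card (upper (Suc k)) + card ?B = card (upper (Suc k) \<union> ?B)"
    by (rule card_Un_disjoint[symmetric]) (auto simp: upper_def outer_boundary_def)
  ultimately show ?thesis by (metis Un_least card_mono)
qed

text \<open>With \<open>L k = 1 + ln (n / t k)\<close>, expansion gives
  \<open>t k \<ge> (1 + \<phi> / L (Suc k)) * t (Suc k)\<close>, so \<open>L\<close> grows by at
  least \<open>\<phi> / (2 * L (Suc k))\<close> in each step. Multiplying by
  \<open>L (Suc k)\<close> shows that the square of \<open>L\<close> grows by at least
  \<open>\<phi> / 2\<close>; this is the source of the square root in the final bound.\<close>

lemma upper_decay: "upper k \<noteq> {} \<Longrightarrow> \<phi> * k / 2 \<le> (1 + ln (n / card (upper k)))\<^sup>2"
proof (induction k)
  case (Suc k)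
  define t where "t = (\<lambda>k. real (card (upper k)))"
  define L where "L = (\<lambda>k. 1 + ln (n / t k))"
  have fin: "finite (upper k)" for k by (simp add: upper_def)
  have ne: "upper k \<noteq> {}" using Suc.prems upper_step[of k] fin
    by (metis add_leD1 card_0_eq card.empty le_zero_eq)
  have pos: "0 < t k" "0 < t (Suc k)" using Suc.prems ne fin by (auto simp: t_def card_gt_0_iff)
  have "upper k \<subseteq> {..<n}" for k using Q(2) by (auto simp: upper_def)
  then have tn: "t k \<le> n" for k unfolding t_def by (metis card_lessThan card_mono finite_lessThan of_nat_le_iff)
  have L1: "1 \<le> L k" "1 \<le> L (Suc k)" using pos tn[of k] tn[of "Suc k"] by (auto simp: L_def)
  have "\<phi> * t (Suc k) \<le> card (outer_boundary G (set Q) (upper (Suc k))) * L (Suc k)"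
    using expand Suc.prems upper_small[of "Suc k"] by (auto simp: expanding_def upper_def t_def L_def)
  also have "\<dots> \<le> (t k - t (Suc k)) * L (Suc k)"
    using upper_step[of k] L1 by (intro mult_right_mono) (auto simp: t_def)
  finally have "\<phi> / L (Suc k) \<le> t k / t (Suc k) - 1" using L1 pos by (simp add: field_simps)
  then have "ln (1 + \<phi> / L (Suc k)) \<le> ln (t k / t (Suc k))"
    using L1 \<phi> pos by (subst ln_le_cancel_iff) (auto intro: add_pos_nonneg)
  also have "\<dots> = L (Suc k) - L k" using pos n_pos by (simp add: L_def ln_div)
  finally have d: "ln (1 + \<phi> / L (Suc k)) \<le> L (Suc k) - L k" .
  have y: "0 \<le> \<phi> / L (Suc k)" "\<phi> / L (Suc k) \<le> 1" using L1 \<phi> by (auto simp: field_simps)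
  define y where "y = \<phi> / L (Suc k)"
  \<comment> \<open>The chain proves \<open>y / 2 \<le> ln (1 + y)\<close> for
    \<open>0 \<le> y \<le> 1\<close>.\<close>
  have "y / 2 \<le> y / (1 + y)" using y by (intro divide_left_mono) (auto simp: y_def)
  also have "\<dots> = 1 - 1 / (1 + y)" using y by (simp add: y_def field_simps)
  also have "\<dots> \<le> - ln (1 / (1 + y))" using y ln_le_minus_one[of "1 / (1 + y)"] by (simp add: y_def)
  also have "\<dots> = ln (1 + y)" using y by (simp add: y_def ln_div)
  also have "\<dots> \<le> L (Suc k) - L k" using d by (simp add: y_def)
  finally have yL: "y / 2 \<le> L (Suc k) - L k" .
  then have "L (Suc k) * (y / 2) \<le> L (Suc k) * (L (Suc k) - L k)" using L1 by (intro mult_left_mono) auto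
  moreover have "L (Suc k) * (y / 2) = \<phi> / 2" using L1 by (simp add: y_def)
  ultimately have 1: "\<phi> / 2 + L (Suc k) * L k \<le> (L (Suc k))\<^sup>2" by (simp add: algebra_simps power2_eq_square)
  have "0 \<le> y / 2" using y by (simp add: y_def)
  then have "L k \<le> L (Suc k)" using yL by linarith
  then have "(L k)\<^sup>2 \<le> L (Suc k) * L k" using L1 by (simp add: power2_eq_square mult_right_mono)
  moreover have "\<phi> * k / 2 \<le> (L k)\<^sup>2" using Suc.IH[OF ne] by (simp add: L_def t_def)
  ultimately have "\<phi> * Suc k / 2 \<le> (L (Suc k))\<^sup>2" using 1 by (simp add: algebra_simps)
  then show ?case by (simp add: L_def t_def)
qed simp

lemma card_upper_le: "card (upper k) \<le> exp (1 - sqrt (\<phi> * k / 2)) * n"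
proof (cases "upper k = {}")
  case False
  let ?t = "card (upper k)"
  have fin: "finite (upper k)" by (simp add: upper_def)
  then have pos: "0 < ?t" using False by (simp add: card_gt_0_iff)
  have "upper k \<subseteq> {..<n}" using Q(2) by (auto simp: upper_def)
  then have tn: "?t \<le> n" by (metis card_lessThan card_mono finite_lessThan)
  have "0 \<le> 1 + ln (n / ?t)" using pos tn by simp
  then have "sqrt (\<phi> * k / 2) \<le> 1 + ln (n / ?t)" using upper_decay[OF False] by (intro real_le_lsqrt) auto
  then have "ln ?t \<le> 1 - sqrt (\<phi> * k / 2) + ln n" using pos n_pos by (simp add: ln_div)
  then have "exp (ln ?t) \<le> exp (1 - sqrt (\<phi> * k / 2) + ln n)" by (simp only: exp_le_cancel_iff)
  then show ?thesis using pos n_pos by (simp add: exp_add)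
qed simp

text \<open>A vertex this high is far at radius \<open>j\<close>, or it is within
  \<open>Suc j\<close> steps of a path vertex, which then lies in \<open>upper k\<close>.\<close>

lemma card_upper_tail:
  fixes k j :: nat
  shows
  "card {v\<in>H. f v > m + Suc k1 + k + Suc j} \<le> (2 * \<beta> ^ j + 4 * C ^ Suc j * sqrt (exp (1 - sqrt (\<phi> * k / 2)))) * n"
proof -
  have "card {v\<in>H. f v > m + Suc k1 + k + Suc j} \<le> 2 * n * \<beta> ^ j + 4 * C ^ Suc j * sqrt (card (upper k) * n)"
  proof (rule card_subset_far_near)
    fix v u assume "v \<in> {v\<in>H. f v > m + Suc k1 + k + Suc j}" "u \<in> set Q" "v \<in> nball (adj G) (Suc j) {u}"
    moreover from this have "\<bar>f v - f u\<bar> \<le> Suc j" by (intro lipschitz_near)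
    ultimately show "u \<in> upper k" by (auto simp: upper_def)
  qed (auto simp: upper_def)
  also have "sqrt (card (upper k) * n) \<le> sqrt (exp (1 - sqrt (\<phi> * k / 2)) * n * n)"
    using card_upper_le[of k] by (intro real_sqrt_le_mono) (simp add: mult_right_mono)
  also have "\<dots> = sqrt (exp (1 - sqrt (\<phi> * k / 2))) * n" by (simp add: real_sqrt_mult)
  finally show ?thesis using C by (simp add: algebra_simps)
qed

lemma card_upper_tail_real:
  fixes b K x :: real
  assumes K: "0 < b" "1 \<le> K"
    and tail: "\<And>k::nat. \<exists>j\<le>k. 2 * \<beta> ^ j + 4 * C ^ Suc j * sqrt (exp (1 - sqrt (\<phi> * k / 2))) \<le> K * exp (- b * sqrt k)"
    and x: "0 \<le> x"
  shows "card {v\<in>H. f v > m + x} \<le> K * exp (b / 2 * sqrt (k1 + 4)) * exp (- b / 2 * sqrt x) * n"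
proof (cases "x \<ge> k1 + 2")
  \<comment> \<open>For small \<open>x\<close> the trivial bound \<open>n\<close> suffices; the
    factor \<open>exp (b / 2 * sqrt (k1 + 4))\<close> pays for it.\<close>
  case False
  have "card {v\<in>H. f v > m + x} \<le> card {..<n}" using H_less by (intro card_mono) auto
  then have "card {v\<in>H. f v > m + x} \<le> 1 * exp 0 * real n" by simp
  also have "\<dots> \<le> K * exp (b / 2 * sqrt (k1 + 4) + - b / 2 * sqrt x) * n"
  proof (intro mult_right_mono mult_mono)
    have "sqrt x \<le> sqrt (k1 + 4)" using False by simp
    then have "b / 2 * sqrt x \<le> b / 2 * sqrt (k1 + 4)" using K by (intro mult_left_mono) auto
    then show "exp 0 \<le> exp (b / 2 * sqrt (k1 + 4) + - b / 2 * sqrt x)" by simp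
  qed (use K in auto)
  finally show ?thesis by (simp only: exp_add mult.assoc)
next
  case True
  \<comment> \<open>The height \<open>x\<close> is spent on the shifts \<open>k1 + 2\<close> and, in
    two equal shares, on \<open>k\<close> and on a radius \<open>j \<le> k\<close>.\<close>
  define k where "k = nat \<lfloor>(x - k1 - 2) / 2\<rfloor>"
  have k: "real k \<le> (x - k1 - 2) / 2" "(x - k1 - 2) / 2 < real k + 1"
  proof -
    have "real k = of_int \<lfloor>(x - k1 - 2) / 2\<rfloor>" using True by (simp add: k_def)
    then show "real k \<le> (x - k1 - 2) / 2" "(x - k1 - 2) / 2 < real k + 1"
      using floor_correct[of "(x - k1 - 2) / 2"] by linarith+
  qed
  obtain j where j: "j \<le> k" "2 * \<beta> ^ j + 4 * C ^ Suc j * sqrt (exp (1 - sqrt (\<phi> * k / 2))) \<le> K * exp (- b * sqrt k)"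
    using tail by blast
  have "{v\<in>H. f v > m + x} \<subseteq> {v\<in>H. f v > m + Suc k1 + k + Suc j}"
    using k(1) j(1) by auto
  then have "card {v\<in>H. f v > m + x} \<le> card {v\<in>H. f v > m + Suc k1 + k + Suc j}"
    using finite_H by (intro card_mono) auto
  then have "card {v\<in>H. f v > m + x} \<le> real (card {v\<in>H. f v > m + Suc k1 + k + Suc j})" by simp
  also have "\<dots> \<le> (2 * \<beta> ^ j + 4 * C ^ Suc j * sqrt (exp (1 - sqrt (\<phi> * k / 2)))) * n"
    by (rule card_upper_tail)
  also have "\<dots> \<le> K * exp (- b * sqrt k) * n" using j(2) by (intro mult_right_mono) auto
  also have "\<dots> \<le> K * exp (b / 2 * sqrt (k1 + 4) + - b / 2 * sqrt x) * n"
  proof (intro mult_right_mono mult_left_mono)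
    \<comment> \<open>Rounding gives \<open>x < 2 * k + k1 + 4\<close>; the first term is enlarged
      to \<open>4 * k\<close> so that its root is \<open>2 * sqrt k\<close>, which halves the rate
      \<open>b\<close>.\<close>
    have "sqrt x \<le> sqrt (4 * k + (k1 + 4))" using k(2) by simp
    also have "\<dots> \<le> sqrt (4 * k) + sqrt (k1 + 4)" by (simp add: sqrt_add_le_add_sqrt)
    also have "sqrt (4 * k) = 2 * sqrt k" by (simp add: real_sqrt_mult)
    finally have "b / 2 * sqrt x \<le> b / 2 * (2 * sqrt k + sqrt (k1 + 4))" using K by (intro mult_left_mono) auto
    then show "exp (- b * sqrt k) \<le> exp (b / 2 * sqrt (k1 + 4) + - b / 2 * sqrt x)" by (simp add: algebra_simps)
  qed (use K in auto)
  finally show ?thesis by (simp only: exp_add mult.assoc)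
qed

end
end

lemma concentration:
  fixes b K :: real
  assumes K: "0 < b" "1 \<le> K"
    and tail: "\<And>k::nat. \<exists>j\<le>k. 2 * \<beta> ^ j + 4 * C ^ Suc j * sqrt (exp (1 - sqrt (\<phi> * k / 2))) \<le> K * exp (- b * sqrt k)"
  shows "concentration_property (2 * (K * exp (b / 2 * sqrt (k1 + 4))) + 1) (exp (b / 2)) n G"
  unfolding concentration_property_def
proof (intro allI impI)
  fix H f m and x :: real
  assume H: "largest_component n G H" and f: "lipschitz_on_graph G H f" and m: "is_median H f m" and x: "0 \<le> x"
  let ?M = "K * exp (b / 2 * sqrt (k1 + 4))" and ?e = "exp (- b / 2 * sqrt x)"
  have f': "lipschitz_on_graph G H (\<lambda>v. - f v)"
    using f by (auto simp: lipschitz_on_graph_def abs_minus_commute)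
  have m1: "card H \<le> 2 * card {v\<in>H. f v \<le> m}" and m2: "card H \<le> 2 * card {v\<in>H. - f v \<le> - m}"
    using m by (auto simp: is_median_def)
  have "card {v\<in>H. \<bar>f v - m\<bar> > x} \<le> card ({v\<in>H. f v > m + x} \<union> {v\<in>H. - f v > - m + x})"
    using finite_H[OF H] by (intro card_mono) auto
  also have "\<dots> \<le> card {v\<in>H. f v > m + x} + card {v\<in>H. - f v > - m + x}" by (rule card_Un_le)
  finally have "real (card {v\<in>H. \<bar>f v - m\<bar> > x}) \<le> card {v\<in>H. f v > m + x} + card {v\<in>H. - f v > - m + x}"
    by linarith
  also have "\<dots> \<le> ?M * ?e * n + ?M * ?e * n"
    using card_upper_tail_real[OF H f m1 K tail x] card_upper_tail_real[OF H f' m2 K tail x] by linarith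
  \<comment> \<open>The summand 1 in the constant makes the inequality strict, as \<open>n\<close>
    is positive.\<close>
  also have "\<dots> < (2 * ?M + 1) * ?e * n"
    using n_pos by (simp add: algebra_simps)
  also have "?e = exp (b / 2) powr (- sqrt x)" by (simp add: powr_def)
  finally show "real (card {v\<in>H. \<bar>f v - m\<bar> > x}) < (2 * ?M + 1) * exp (b / 2) powr (- sqrt x) * n" .
qed

end

section \<open>Choice of the transfer radius\<close>

text \<open>The radius \<open>j\<close> is about \<open>\<zeta> * sqrt k\<close>: large enough for
  \<open>\<beta> ^ j\<close> to decay exponentially in \<open>sqrt k\<close>, and small enough for
  \<open>C ^ j\<close> to take away at most half of the decay \<open>exp (- a * sqrt k / 2)\<close>
  of the second summand.\<close>

lemma stretched_tail:
  fixes \<beta> C \<phi> :: real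
  assumes \<beta>: "0 < \<beta>" "\<beta> < 1" and C: "1 \<le> C" and \<phi>: "0 < \<phi>"
  shows "\<exists>b K. 0 < b \<and> 1 \<le> K \<and>
    (\<forall>k::nat. \<exists>j\<le>k. 2 * \<beta> ^ j + 4 * C ^ Suc j * sqrt (exp (1 - sqrt (\<phi> * k / 2))) \<le> K * exp (- b * sqrt k))"
proof -
  define a where "a = sqrt (\<phi> / 2)"
  define l where "l = ln C"
  define B where "B = - ln \<beta>"
  \<comment> \<open>The bound 1 ensures \<open>j \<le> k\<close>; the denominator
    \<open>l + 1\<close> stays positive also for \<open>C = 1\<close>.\<close>
  define \<zeta> where "\<zeta> = min 1 (a / 4 / (l + 1))"
  define b where "b = min (a / 4) (\<zeta> * B)"
  \<comment> \<open>\<open>exp B\<close> compensates the rounding in \<open>j\<close>, and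
    \<open>exp 1\<close> bounds the factor \<open>exp (1 / 2)\<close> of the second summand.\<close>
  define K where "K = 2 * exp B + 4 * C * exp 1"
  have a: "0 < a" using \<phi> by (simp add: a_def)
  have l: "0 \<le> l" using C by (simp add: l_def)
  have B: "0 < B" using \<beta> by (simp add: B_def)
  have \<zeta>: "0 < \<zeta>" "\<zeta> \<le> 1" using a l by (auto simp: \<zeta>_def)
  have \<zeta>l: "l * \<zeta> \<le> a / 4"
  proof -
    have "(l + 1) * \<zeta> \<le> (l + 1) * (a / 4 / (l + 1))" using l by (intro mult_left_mono) (auto simp: \<zeta>_def)
    also have "\<dots> = a / 4"
    proof -
      have "y * (a / 4 / y) = a / 4" if "y \<noteq> 0" for y :: real using that by simp
      then show ?thesis using l by (metis add_nonneg_eq_0_iff zero_le_one zero_neq_one)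
    qed
    finally show ?thesis using \<zeta> by (simp add: distrib_right)
  qed
  have b: "0 < b" using a B \<zeta> by (auto simp: b_def)
  have "1 * 1 \<le> C * exp 1" using C by (intro mult_mono) auto
  moreover have "0 < exp B" by simp
  ultimately have K: "1 \<le> K" unfolding K_def by linarith
  have "\<exists>j\<le>k. 2 * \<beta> ^ j + 4 * C ^ Suc j * sqrt (exp (1 - sqrt (\<phi> * k / 2))) \<le> K * exp (- b * sqrt k)" for k :: nat
  proof (intro exI conjI)
    let ?r = "sqrt k" and ?j = "nat \<lfloor>\<zeta> * sqrt k\<rfloor>"
    have r0: "0 \<le> \<zeta> * ?r" using \<zeta> by simp
    have "real ?j = of_int \<lfloor>\<zeta> * ?r\<rfloor>" using r0 by simp
    then have j: "real ?j \<le> \<zeta> * ?r" "\<zeta> * ?r - 1 \<le> real ?j"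
      using floor_correct[of "\<zeta> * ?r"] by linarith+
    have rk: "?r \<le> k"
    proof -
      have "k \<le> k\<^sup>2" by (cases k) (auto simp: power2_eq_square)
      then have "real k \<le> (real k)\<^sup>2" by (metis of_nat_le_iff of_nat_power)
      then show ?thesis by (rule real_le_lsqrt[rotated]) simp
    qed
    have "\<zeta> * ?r \<le> 1 * ?r" using \<zeta> by (intro mult_right_mono) auto
    then show "?j \<le> k" using j(1) rk by linarith
    have "\<beta> ^ ?j = exp (?j * - B)" unfolding exp_of_nat_mult using \<beta> by (simp add: B_def)
    also have "\<dots> \<le> exp (B + - b * ?r)"
    proof -
      have "b * ?r \<le> (\<zeta> * B) * ?r" by (intro mult_right_mono) (auto simp: b_def)
      moreover have "B * (\<zeta> * ?r - 1) \<le> B * ?j" using j(2) B by (intro mult_left_mono) auto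
      ultimately show ?thesis by (simp add: algebra_simps)
    qed
    finally have 1: "\<beta> ^ ?j \<le> exp B * exp (- b * ?r)" by (simp only: exp_add)
    have "C ^ Suc ?j * sqrt (exp (1 - sqrt (\<phi> * k / 2))) = C * (exp (?j * l) * exp ((1 - a * ?r) / 2))"
    proof -
      have "sqrt (\<phi> * k / 2) = a * ?r" by (simp add: a_def flip: real_sqrt_mult)
      moreover have "sqrt (exp y) = exp (y / 2)" for y :: real
        by (rule real_sqrt_unique) (auto simp: power2_eq_square simp flip: exp_add)
      moreover have "C ^ ?j = exp (?j * l)" unfolding exp_of_nat_mult using C by (simp add: l_def)
      ultimately show ?thesis by simp
    qed
    also have "\<dots> \<le> C * exp (1 + - b * ?r)"
    proof (intro mult_left_mono)
      have "?j * l \<le> \<zeta> * ?r * l" using j(1) l by (intro mult_right_mono) auto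
      also have "\<dots> = (l * \<zeta>) * ?r" by simp
      also have "\<dots> \<le> a / 4 * ?r" using \<zeta>l by (intro mult_right_mono) auto
      finally have "?j * l \<le> a / 4 * ?r" .
      moreover have "b * ?r \<le> a / 4 * ?r" by (intro mult_right_mono) (auto simp: b_def)
      ultimately have "?j * l + (1 - a * ?r) / 2 \<le> 1 + - b * ?r" by (simp add: diff_divide_distrib)
      then show "exp (?j * l) * exp ((1 - a * ?r) / 2) \<le> exp (1 + - b * ?r)" by (simp flip: exp_add)
    qed (use C in auto)
    finally have 2: "C ^ Suc ?j * sqrt (exp (1 - sqrt (\<phi> * k / 2))) \<le> C * (exp 1 * exp (- b * ?r))"
      by (simp only: exp_add)
    show "2 * \<beta> ^ ?j + 4 * C ^ Suc ?j * sqrt (exp (1 - sqrt (\<phi> * k / 2))) \<le> K * exp (- b * ?r)"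
      using 1 2 unfolding K_def by (simp add: distrib_right mult.assoc)
  qed
  then show ?thesis using b K by blast
qed

section \<open>The giant component\<close>

text \<open>The search runs until about \<open>s = \<delta> * n\<close> vertices are visited, with
  target length about \<open>l = \<delta> * s\<close>. Failure means that at least
  \<open>(1 - \<delta>) * s * ((1 - \<delta>) * n)\<close> queries, with at least
  \<open>c2 * s\<close> expected edges, produced at most \<open>s\<close> edges; this is unlikely
  because \<open>c2 > 1\<close>.\<close>

lemma supercritical_path:
  fixes c :: real
  assumes c: "1 < c"
  shows "\<exists>(\<gamma>::real) l. 0 < \<gamma> \<and> (\<forall>\<^sub>F n in sequentially. \<gamma> * n \<le> real (l n)) \<and>
    (\<lambda>n. measure_pmf.prob (gnp n (c / n)) {G. \<not> has_path n G (l n)}) \<longlonglongrightarrow> 0"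
proof -
  \<comment> \<open>\<open>\<delta>\<close> is chosen so that
    \<open>(1 - \<delta>) * (1 - \<delta>) * c\<close> is still \<open>c2 > 1\<close>.\<close>
  define c2 where "c2 = sqrt c"
  define \<delta> where "\<delta> = 1 - 1 / sqrt c2"
  define \<kappa> where "\<kappa> = c2 - 1 - ln c2"
  define s where "s = (\<lambda>n::nat. nat \<lfloor>\<delta> * n\<rfloor>)"
  define l where "l = (\<lambda>n. nat \<lfloor>\<delta> * s n\<rfloor>)"
  have c2: "1 < c2" using c by (simp add: c2_def)
  then have c4: "1 < sqrt c2" by simp
  have \<delta>: "0 < \<delta>" "\<delta> < 1" using c4 by (auto simp: \<delta>_def)
  have \<delta>c: "(1 - \<delta>) * (1 - \<delta>) * c = c2"
  proof -
    have "(1 - \<delta>) * (1 - \<delta>) = 1 / c2" using c2 by (simp add: \<delta>_def)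
    moreover have "c = c2 * c2" using c by (simp add: c2_def)
    ultimately show ?thesis using c2 by simp
  qed
  have \<kappa>: "0 < \<kappa>" using c2 ln_le_minus_one[of c2] ln_eq_minus_one[of c2] by (force simp: \<kappa>_def)
  have s: "real (s n) \<le> \<delta> * n" "\<delta> * n - 1 \<le> real (s n)" for n
  proof -
    have "real (s n) = of_int \<lfloor>\<delta> * n\<rfloor>" using \<delta> by (simp add: s_def)
    then show "real (s n) \<le> \<delta> * n" "\<delta> * n - 1 \<le> real (s n)" using floor_correct[of "\<delta> * n"] by linarith+
  qed
  have l: "real (l n) \<le> \<delta> * s n" "\<delta> * s n - 1 \<le> real (l n)" for n
  proof -
    have "real (l n) = of_int \<lfloor>\<delta> * s n\<rfloor>" using \<delta> by (simp add: l_def)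
    then show "real (l n) \<le> \<delta> * s n" "\<delta> * s n - 1 \<le> real (l n)" using floor_correct[of "\<delta> * s n"] by linarith+
  qed
  have ev: "\<forall>\<^sub>F n in sequentially. 4 / \<delta>\<^sup>2 \<le> real n" by real_asymp
  have "\<forall>\<^sub>F n in sequentially. \<delta>\<^sup>2 / 2 * n \<le> real (l n)"
    using ev
  proof eventually_elim
    case (elim n)
    have "\<delta> * (\<delta> * n - 1) \<le> \<delta> * s n" using s(2) \<delta> by (intro mult_left_mono) auto
    moreover have "2 \<le> \<delta>\<^sup>2 / 2 * n" using elim \<delta> by (simp add: field_simps)
    moreover have "\<delta> * (\<delta> * n - 1) = \<delta>\<^sup>2 / 2 * n + \<delta>\<^sup>2 / 2 * n - \<delta>"
      by (simp add: algebra_simps power2_eq_square)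
    ultimately show ?case using l(2)[of n] \<delta> by linarith
  qed
  moreover have "(\<lambda>n. measure_pmf.prob (gnp n (c / n)) {G. \<not> has_path n G (l n)}) \<longlonglongrightarrow> 0"
  proof (rule tendsto_sandwich[OF _ _ tendsto_const])
    show "(\<lambda>n. exp (- \<kappa> * (\<delta> * real n - 1))) \<longlonglongrightarrow> 0" using \<kappa> \<delta> by real_asymp
    have "\<forall>\<^sub>F n in sequentially. c \<le> real n" by real_asymp
    then show "\<forall>\<^sub>F n in sequentially. measure_pmf.prob (gnp n (c / n)) {G. \<not> has_path n G (l n)} \<le> exp (- \<kappa> * (\<delta> * real n - 1))"
    proof eventually_elim
      case (elim n)
      \<comment> \<open>\<open>?y = 1 / c2\<close> minimises the Chernoff exponent and yields the
        rate \<open>\<kappa>\<close>, which is positive because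
        \<open>ln c2 < c2 - 1\<close>.\<close>
      let ?p = "c / n" and ?y = "1 / c2" and ?t = "(s n - l n) * (n - s n)"
      have n: "0 < real n" using elim c by linarith
      have p: "0 \<le> ?p" "?p \<le> 1" using elim c n by auto
      have y: "0 < ?y" "?y \<le> 1" using c2 by auto
      have "real (s n) \<le> 1 * n" using s(1)[of n] \<delta> mult_right_mono[of \<delta> 1 "real n"] by linarith
      then have sn: "s n \<le> n" by simp
      have "real (l n) \<le> 1 * s n" using l(1)[of n] \<delta> mult_right_mono[of \<delta> 1 "real (s n)"] by linarith
      then have ls: "l n \<le> s n" by simp
      have "((1 - \<delta>) * s n) * ((1 - \<delta>) * n) \<le> real (s n - l n) * real (n - s n)"
        using s(1)[of n] l(1)[of n] sn ls \<delta> mult_right_mono[of \<delta> 1 "real n"]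
        by (intro mult_mono) (auto simp: of_nat_diff algebra_simps)
      then have "?p * (((1 - \<delta>) * s n) * ((1 - \<delta>) * n)) \<le> ?p * ?t"
        using p by (intro mult_left_mono) auto
      moreover have "?p * (((1 - \<delta>) * s n) * ((1 - \<delta>) * n)) = c2 * s n"
        using n \<delta>c by (simp add: mult_ac)
      ultimately have t: "c2 * s n \<le> ?p * ?t" by simp
      have "measure_pmf.prob (gnp n ?p) {G. \<not> has_path n G (l n)} \<le> (1 - ?p * (1 - ?y)) ^ ?t * (1 / ?y) ^ s n"
        by (rule prob_no_path_le[OF p y sn])
      also have "\<dots> \<le> exp (- (?p * (1 - ?y))) ^ ?t * (1 / ?y) ^ s n"
      proof (intro mult_right_mono power_mono)
        show "1 - ?p * (1 - ?y) \<le> exp (- (?p * (1 - ?y)))"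
          using exp_ge_add_one_self[of "- (?p * (1 - ?y))"] by simp
        show "0 \<le> 1 - ?p * (1 - ?y)" using p y mult_le_one[of ?p "1 - ?y"] by auto
      qed (use y in auto)
      also have "\<dots> = exp (?t * - (?p * (1 - ?y))) * exp (s n * ln c2)"
      proof -
        have "(1 / ?y) ^ s n = exp (s n * ln c2)" unfolding exp_of_nat_mult using c2 by simp
        then show ?thesis by (simp only: exp_of_nat_mult)
      qed
      also have "\<dots> = exp (s n * ln c2 - (?p * ?t) * (1 - ?y))" by (simp add: mult_ac flip: exp_add)
      also have "\<dots> \<le> exp (s n * ln c2 - (c2 * s n) * (1 - ?y))"
      proof -
        have "(c2 * s n) * (1 - ?y) \<le> (?p * ?t) * (1 - ?y)" using t y by (intro mult_right_mono) auto
        then show ?thesis by simp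
      qed
      also have "s n * ln c2 - (c2 * s n) * (1 - ?y) = - \<kappa> * s n" using c2 by (simp add: \<kappa>_def field_simps)
      also have "exp (- \<kappa> * s n) \<le> exp (- \<kappa> * (\<delta> * real n - 1))" using s(2)[of n] \<kappa> by simp
      finally show ?case .
    qed
  qed auto
  ultimately show ?thesis using \<delta> by (intro exI[of _ "\<delta>\<^sup>2 / 2"] exI[of _ l]) auto
qed

theorem theorem3p3:
  fixes c :: real
  assumes "c > 1"
  shows "\<exists>Cb CB. Cb > 0 \<and> CB > 1 \<and>
    ((\<lambda>n. measure_pmf.prob (gnp n (c / real n)) {G. concentration_property Cb CB n G})
       \<longlongrightarrow> 1) sequentially"
proof -
  \<comment> \<open>Half of the excess \<open>c - 1\<close> stays with the path, the other half is
    used for sprinkling.\<close>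
  define c1 where "c1 = (1 + c) / 2"
  define \<epsilon> where "\<epsilon> = (c - 1) / 2"
  have c1: "1 < c1" "c1 + \<epsilon> = c" and \<epsilon>: "0 < \<epsilon>" using assms by (auto simp: c1_def \<epsilon>_def field_simps)
  obtain \<gamma> :: real and l where \<gamma>: "0 < \<gamma>" and l: "\<forall>\<^sub>F n in sequentially. \<gamma> * n \<le> real (l n)"
    and path: "(\<lambda>n. measure_pmf.prob (gnp n (c1 / n)) {G. \<not> has_path n G (l n)}) \<longlonglongrightarrow> 0"
    using supercritical_path[OF c1(1)] by blast
  define C where "C = 4 * c"
  have C: "1 < C" using assms by (simp add: C_def)
  \<comment> \<open>A vertex has no sprinkled edge to a path of at least \<open>\<gamma> * n\<close>
    vertices with probability at most
    \<open>exp (- \<epsilon> * \<gamma>) = \<beta>\<^sup>2\<close>.\<close>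
  define B where "B = \<epsilon> * \<gamma> / 2"
  define \<beta> where "\<beta> = exp (- B)"
  have B: "0 < B" using \<epsilon> \<gamma> by (simp add: B_def)
  have \<beta>: "0 < \<beta>" "\<beta> < 1" using B by (auto simp: \<beta>_def)
  obtain k1 where "\<beta> ^ k1 < \<gamma> / 16" using real_arch_pow_inv[of "\<gamma> / 16" \<beta>] \<gamma> \<beta> by auto
  then have k1: "16 * \<beta> ^ k1 \<le> \<gamma>" by simp
  define \<eta> where "\<eta> = (\<gamma> / (16 * C ^ Suc k1))\<^sup>2"
  have \<eta>: "0 < \<eta>" using \<gamma> C by (simp add: \<eta>_def)
  \<comment> \<open>\<open>\<kappa>\<close> is the decay rate available for expansion; the two
    counting costs and the remaining rate \<open>\<rho>\<close> get at most a quarter of it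
    each.\<close>
  define \<kappa> where "\<kappa> = \<epsilon> * \<gamma> * \<eta> / 2"
  have \<kappa>: "0 < \<kappa>" using \<epsilon> \<gamma> \<eta> by (simp add: \<kappa>_def)
  define \<delta> where "\<delta> = min 1 (\<kappa> / 8)"
  have \<delta>: "0 < \<delta>" "\<delta> \<le> 1" "2 * \<delta> \<le> \<kappa> / 4" using \<kappa> by (auto simp: \<delta>_def)
  have ln\<delta>: "0 \<le> ln (1 / \<delta>)" using \<delta> by simp
  define \<phi> where "\<phi> = min (min 1 (\<eta> / 2)) (\<kappa> / 12 / (1 + ln (1 / \<delta>)))"
  have \<phi>: "0 < \<phi>" "\<phi> \<le> \<eta> / 2" "\<phi> \<le> 1"
  proof -
    have "0 < \<kappa> / 12 / (1 + ln (1 / \<delta>))" using \<kappa> ln\<delta> by (intro divide_pos_pos add_pos_nonneg) auto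
    then show "0 < \<phi>" using \<eta> unfolding \<phi>_def by simp
    show "\<phi> \<le> \<eta> / 2" "\<phi> \<le> 1" unfolding \<phi>_def by linarith+
  qed
  have \<phi>\<kappa>: "3 * \<phi> * (1 + ln (1 / \<delta>)) \<le> \<kappa> / 4"
  proof -
    have "\<phi> * (1 + ln (1 / \<delta>)) \<le> \<kappa> / 12 / (1 + ln (1 / \<delta>)) * (1 + ln (1 / \<delta>))"
      using ln\<delta> by (intro mult_right_mono) (auto simp: \<phi>_def)
    also have "\<dots> = \<kappa> / 12"
    proof -
      have "\<kappa> / 12 / y * y = \<kappa> / 12" if "y \<noteq> 0" for y :: real using that by simp
      then show ?thesis using ln\<delta> by (metis add_nonneg_eq_0_iff zero_le_one zero_neq_one)
    qed
    finally show ?thesis by simp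
  qed
  define \<rho> where "\<rho> = \<kappa> / 4"
  have \<rho>: "0 < \<rho>" "2 * \<delta> + 3 * \<phi> * (1 + ln (1 / \<delta>)) + \<rho> \<le> \<epsilon> * \<gamma> * \<eta> / 2"
    using \<kappa> \<delta> \<phi>\<kappa> unfolding \<rho>_def \<kappa>_def[symmetric] by linarith+
  define D where "D = C\<^sup>2 / \<beta>\<^sup>2"
  have D: "1 < D"
  proof -
    have "\<beta>\<^sup>2 < 1\<^sup>2" using \<beta> by (intro power_strict_mono) auto
    also have "\<dots> < C\<^sup>2" using C by (intro power_strict_mono) auto
    finally show ?thesis using \<beta> by (simp add: D_def)
  qed
  \<comment> \<open>\<open>s\<close> solves \<open>s * ln D - (1 - s) * B = - B / 2\<close>, so the
    weighted geometric mean of the two tail bounds has ratio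
    \<open>x = exp (- B / 2)\<close>.\<close>
  define s where "s = B / 2 / (ln D + B)"
  have lnD: "0 < ln D" using D by simp
  have s: "0 < s" "s \<le> 1" using B lnD by (auto simp: s_def)
  define x where "x = exp (- B / 2)"
  have x: "x < 1" "(C\<^sup>2 / \<beta>\<^sup>2) powr s * \<beta> powr (1 - s) \<le> x"
  proof -
    show "x < 1" using B by (simp add: x_def)
    have "B / 2 / y * y = B / 2" if "y \<noteq> 0" for y :: real using that by simp
    then have "s * (ln D + B) = B / 2" unfolding s_def using B lnD by (metis add_pos_pos less_irrefl)
    then have "s * ln D + (1 - s) * - B = - B / 2" by (simp add: algebra_simps)
    then have "D powr s * \<beta> powr (1 - s) = x"
      using D \<beta> by (simp add: powr_def x_def \<beta>_def flip: exp_add)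
    then show "(C\<^sup>2 / \<beta>\<^sup>2) powr s * \<beta> powr (1 - s) \<le> x" by (simp add: D_def)
  qed
  obtain b K where K: "0 < b" "1 \<le> K" "\<And>k::nat. \<exists>j\<le>k. 2 * \<beta> ^ j + 4 * C ^ Suc j * sqrt (exp (1 - sqrt (\<phi> * k / 2))) \<le> K * exp (- b * sqrt k)"
    using stretched_tail[OF \<beta> less_imp_le[OF C] \<phi>(1)] by blast
  define Cb where "Cb = 2 * (K * exp (b / 2 * sqrt (k1 + 4))) + 1"
  define CB where "CB = exp (b / 2)"
  have Cb: "0 < Cb" using K by (simp add: Cb_def add_pos_pos)
  have CB: "1 < CB" using K by (simp add: CB_def)
  define err where "err = (\<lambda>n::nat. 2 * exp (- \<rho> / 4 * ln n) / (1 - exp (- \<rho> / 2)) + 4 * n powr (- s / 2) / (1 - x))"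
  have err: "err \<longlonglongrightarrow> 0"
  proof -
    have "(\<lambda>n::nat. exp (- \<rho> / 4 * ln n)) \<longlonglongrightarrow> 0" using \<rho>(1) by real_asymp
    moreover have "(\<lambda>n::nat. n powr (- s / 2)) \<longlonglongrightarrow> 0" using s(1) by real_asymp
    ultimately have "err \<longlonglongrightarrow> 2 * 0 / (1 - exp (- \<rho> / 2)) + 4 * 0 / (1 - x)"
      unfolding err_def using \<rho>(1) x(1) by (intro tendsto_intros) auto
    then show ?thesis by simp
  qed
  define bound where "bound = (\<lambda>n::nat. real n * real n * exp (- sqrt n) +
     measure_pmf.prob (gnp n (c1 / n)) {G. \<not> has_path n G (l n)} + err n)"
  have "(\<lambda>n::nat. real n * real n * exp (- sqrt n)) \<longlonglongrightarrow> 0" by real_asymp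
  then have bound: "bound \<longlonglongrightarrow> 0"
    unfolding bound_def using tendsto_add[OF tendsto_add[OF _ path] err] by force
  have n1: "\<forall>\<^sub>F n in sequentially. 2 * c \<le> real n" by real_asymp
  have n2: "\<forall>\<^sub>F n in sequentially. real k1 < \<gamma> * real n" using \<gamma> by real_asymp
  have main: "\<forall>\<^sub>F n in sequentially. 1 - bound n \<le> measure_pmf.prob (gnp n (c / n)) {G. concentration_property Cb CB n G}"
    using l n1 n2
  proof eventually_elim
    case (elim n)
    let ?p = "c / n" and ?p1 = "c1 / n"
    \<comment> \<open>Solves \<open>1 - ?p = (1 - ?p1) * (1 - p2)\<close>, so that overlaying the
      two graphs gives edge probability \<open>?p\<close>; dividing by
      \<open>1 - ?p1 \<le> 1\<close> keeps \<open>p2\<close> at least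
      \<open>\<epsilon> / n\<close>.\<close>
    define p2 where "p2 = (?p - ?p1) / (1 - ?p1)"
    have n: "0 < real n" "1 \<le> n" using elim(2) assms by auto
    have p: "0 \<le> ?p" "?p \<le> 1" "?p * n \<le> c" using elim(2) assms n by auto
    have p1: "0 \<le> ?p1" "?p1 \<le> 1 / 2" "?p1 \<le> ?p" using elim(2) c1 \<epsilon> assms n by (auto simp: field_simps)
    have p2: "\<epsilon> / n \<le> p2" "p2 \<le> 1" "0 \<le> p2"
    proof -
      have e: "\<epsilon> / n = ?p - ?p1" using c1(2) by (simp flip: diff_divide_distrib)
      show "0 \<le> p2" unfolding p2_def using p1 by (intro divide_nonneg_nonneg) linarith+
      have "(?p - ?p1) / 1 \<le> p2" unfolding p2_def using p1 by (intro divide_left_mono mult_pos_pos) linarith+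
      then show "\<epsilon> / n \<le> p2" unfolding e by simp
      show "p2 \<le> 1" unfolding p2_def using p1 p by (subst divide_le_eq_1_pos) linarith+
    qed
    have prod: "1 - ?p = (1 - ?p1) * (1 - p2)"
    proof -
      have "1 - (y + z) = (1 - y) * (1 - z / (1 - y))" if "y \<noteq> 1" for y z :: real
        using that by (simp add: right_diff_distrib)
      moreover have "?p1 \<noteq> 1" using p1 by linarith
      ultimately have "1 - (?p1 + (?p - ?p1)) = (1 - ?p1) * (1 - p2)" unfolding p2_def by blast
      then show ?thesis by simp
    qed
    let ?or = "\<lambda>x e. fst x e \<or> snd x e"
    let ?M = "pair_pmf (gnp n ?p1) (gnp n p2)"
    have gnp: "gnp n ?p = map_pmf ?or ?M"
    proof -
      have "?p1 \<le> 1" using p1(2) by linarith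
      from rgraph_or[OF finite_gnp_pairs p1(1) this p2(3,2) prod] show ?thesis
        by (simp only: gnp_eq_rgraph case_prod_unfold)
    qed
    have fin: "finite (set_pmf (gnp n r))" for r
      unfolding gnp_eq_rgraph by (intro finite_set_rgraph finite_gnp_pairs)
    let ?conc = "\<lambda>x. concentration_property Cb CB n (?or x)"
    \<comment> \<open>The failures of slow growth, which concerns the overlay, and of the path
      search, which concerns the first graph only, are split off; \<open>?E\<close> is what
      remains.\<close>
    let ?E = "\<lambda>x. has_path n (fst x) (l n) \<and> slow_growth n C (?or x) \<and> \<not> ?conc x"
    have "measure_pmf.prob (gnp n ?p) {G. \<not> concentration_property Cb CB n G}
      = measure_pmf.prob ?M {x. \<not> ?conc x}"
      unfolding gnp by (simp add: vimage_def)
    also have "\<dots> \<le> measure_pmf.prob ?M {x. (\<not> slow_growth n C (?or x) \<or> \<not> has_path n (fst x) (l n)) \<or> ?E x}"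
      by (rule prob_pmf_mono_support) blast
    also have "\<dots> \<le> (measure_pmf.prob ?M {x. \<not> slow_growth n C (?or x)} + measure_pmf.prob ?M {x. \<not> has_path n (fst x) (l n)})
        + measure_pmf.prob ?M {x. ?E x}"
      by (intro order_trans[OF prob_pmf_disj_le] add_mono prob_pmf_disj_le order_refl)
    also have "\<dots> \<le> bound n"
      unfolding bound_def
    proof (intro add_mono)
      have "measure_pmf.prob ?M {x. \<not> slow_growth n C (?or x)} = measure_pmf.prob (gnp n ?p) {G. \<not> slow_growth n C G}"
        unfolding gnp by (simp add: vimage_def)
      also have "\<dots> \<le> real n * real n * exp (- sqrt n)"
        unfolding C_def using prob_not_slow_growth_le[of ?p n c] p assms n by simp
      finally show "measure_pmf.prob ?M {x. \<not> slow_growth n C (?or x)} \<le> real n * real n * exp (- sqrt n)" .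
      have "measure_pmf.prob ?M {x. \<not> has_path n (fst x) (l n)} = measure_pmf.prob (map_pmf fst ?M) {G. \<not> has_path n G (l n)}"
        by (simp add: vimage_def)
      then show "measure_pmf.prob ?M {x. \<not> has_path n (fst x) (l n)} \<le> measure_pmf.prob (gnp n ?p1) {G. \<not> has_path n G (l n)}"
        by (simp add: map_fst_pair_pmf)
      show "measure_pmf.prob ?M {x. ?E x} \<le> err n"
      \<comment> \<open>Conditioning on the first graph fixes the path \<open>Q\<close> while the
        sprinkled graph \<open>h\<close> is still fully random.\<close>
      proof (rule prob_pair_finite_le[OF fin fin])
        fix g assume g: "g \<in> set_pmf (gnp n ?p1)"
        have gp: "g e \<Longrightarrow> e \<in> gnp_pairs n" for e using g set_rgraphD[OF finite_gnp_pairs] unfolding gnp_eq_rgraph by blast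
        have err0: "0 \<le> err n" using \<rho> x by (simp add: err_def)
        show "measure_pmf.prob (gnp n p2) {h. (g, h) \<in> {x. ?E x}} \<le> err n"
        proof (cases "has_path n g (l n)")
          case False
          then show ?thesis using err0 by simp
        next
          case True
          then obtain Q where Q: "distinct Q" "set Q \<subseteq> {..<n}" "length Q = l n" "successively (adj g) Q"
            by (auto simp: has_path_def)
          have Ql: "\<gamma> * n \<le> length Q" using elim(1) Q by simp
          let ?G = "\<lambda>h e. g e \<or> h e"
          have \<beta>2: "(1 - p2) ^ card (set Q) \<le> \<beta>\<^sup>2"
          proof -
            have "(1 - p2) ^ card (set Q) \<le> exp (- p2) ^ card (set Q)"
              using p2 exp_ge_add_one_self[of "- p2"] by (intro power_mono) auto
            also have "\<dots> = exp (- (p2 * length Q))" using Q(1) by (simp add: distinct_card mult.commute flip: exp_of_nat_mult)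
            also have "\<dots> \<le> exp (- (\<epsilon> / n * (\<gamma> * n)))"
            proof -
              have "\<epsilon> / n * (\<gamma> * n) \<le> p2 * length Q" using p2 Ql \<epsilon> \<gamma> by (intro mult_mono) auto
              then show ?thesis by simp
            qed
            also have "\<dots> = \<beta>\<^sup>2" using n by (simp add: \<beta>_def B_def power2_eq_square flip: exp_add)
            finally show ?thesis .
          qed
          have "measure_pmf.prob (gnp n p2) {h. (g, h) \<in> {x. ?E x}}
            \<le> measure_pmf.prob (gnp n p2) {h. \<not> expanding n \<eta> \<phi> (set Q) (?G h) \<or>
                (slow_growth n C (?G h) \<and> \<not> few_far n \<beta> (set Q) (?G h))}"
          proof (rule prob_pmf_mono_support, rule ccontr)
            fix h assume h: "h \<in> set_pmf (gnp n p2)" and hE: "(g, h) \<in> {x. ?E x}"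
              and *: "\<not> (\<not> expanding n \<eta> \<phi> (set Q) (?G h) \<or> (slow_growth n C (?G h) \<and> \<not> few_far n \<beta> (set Q) (?G h)))"
            have hp: "h e \<Longrightarrow> e \<in> gnp_pairs n" for e using h set_rgraphD[OF finite_gnp_pairs] unfolding gnp_eq_rgraph by blast
            \<comment> \<open>With expansion and few far vertices at hand, the deterministic
              argument gives concentration and contradicts \<open>?E\<close>.\<close>
            interpret giant n "?G h" Q C \<beta> \<gamma> \<eta> \<phi> k1
            proof
              show "successively (adj (?G h)) Q"
                using Q(4) by (rule successively_mono) (auto simp: adj_def)
              show "\<And>e. g e \<or> h e \<Longrightarrow> e \<in> gnp_pairs n" using gp hp by blast
            qed (use Q Ql \<gamma> elim(3) hE * C \<beta> k1 \<eta>_def \<phi> in auto)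
            from concentration[OF K] show False using hE unfolding Cb_def[symmetric] CB_def[symmetric] by simp
          qed
          also have "\<dots> \<le> measure_pmf.prob (gnp n p2) {h. \<not> expanding n \<eta> \<phi> (set Q) (?G h)} +
             measure_pmf.prob (gnp n p2) {h. slow_growth n C (?G h) \<and> \<not> few_far n \<beta> (set Q) (?G h)}"
            by (rule prob_pmf_disj_le)
          also have "\<dots> \<le> err n"
            unfolding err_def
          proof (intro add_mono)
            show "measure_pmf.prob (gnp n p2) {h. \<not> expanding n \<eta> \<phi> (set Q) (?G h)} \<le> 2 * exp (- \<rho> / 4 * ln n) / (1 - exp (- \<rho> / 2))"
              by (rule prob_not_expanding_le[OF p2(1,2) \<epsilon> \<eta> \<phi> \<delta>(1,2) \<rho> Q(1,2,4) Ql n(2)])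
            show "measure_pmf.prob (gnp n p2) {h. slow_growth n C (?G h) \<and> \<not> few_far n \<beta> (set Q) (?G h)} \<le> 4 * n powr (- s / 2) / (1 - x)"
              by (rule prob_many_far_le[OF p2(3,2) \<beta>(1) \<beta>2 \<beta>(2) s x less_imp_le[OF C] Q(2) gp n(2)])
          qed
          finally show ?thesis .
        qed
      qed
    qed
    finally have "measure_pmf.prob (gnp n ?p) {G. \<not> concentration_property Cb CB n G} \<le> bound n" .
    moreover have "measure_pmf.prob (gnp n ?p) {G. \<not> concentration_property Cb CB n G} =
       1 - measure_pmf.prob (gnp n ?p) {G. concentration_property Cb CB n G}"
      using measure_pmf.prob_compl[of "{G. concentration_property Cb CB n G}" "gnp n ?p"]
      by (simp add: Compl_eq_Diff_UNIV[symmetric] Collect_neg_eq[symmetric])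
    ultimately show ?case by linarith
  qed
  have "(\<lambda>n. measure_pmf.prob (gnp n (c / n)) {G. concentration_property Cb CB n G}) \<longlonglongrightarrow> 1"
  proof (rule tendsto_sandwich[OF main])
    show "(\<lambda>n. 1 - bound n) \<longlonglongrightarrow> 1" using tendsto_diff[OF tendsto_const bound] by simp
  qed auto
  then show ?thesis using Cb CB by blast
qed

end
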